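(* Let $p$ be a prime, let $t\leq 7$ be a positive integer and let $A$ be a finite subset of $\mathbb{Z}_p\setminus\{0\}$ such that $|A\cap\{x,-x\}|\leq 1$ for any $x\in\mathbb{Z}_p$ and $|A|>t$. Then $A$ is $t$-weak sequenceable.
   Context: Let $G$ be an abelian group, $t$ a positive integer, and $A\subseteq G\setminus\{0\}$ a finite subset with $k=|A|>t$. For an ordering $(a_1,\ldots,a_k)$ of the elements of $A$ (each element listed exactly once), the partial sums are $s_0=0$ and $s_i=a_1+\cdots+a_i$ for $1\leq i\leq k$. The ordering is a $t$-weak sequencing of $A$ if $s_i\neq s_j$ for all $i,j\in\{0,1,\ldots,k\}$ with $i\neq j$ and $|i-j|\leq t$. The set $A$ is $t$-weak sequenceable if it admits a $t$-weak sequencing. *)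

theory Defs
  imports "HOL-Algebra.Elementary_Groups" "HOL-Algebra.FiniteProduct" "HOL-Computational_Algebra.Primes"
begin

text \<open>
  Abelian groups are the multiplicatively written \<open>comm_group\<close>s of HOL-Algebra, so the
  zero, the opposite and the sums of an additively written group appear here as \<open>\<one>\<close>,
  \<open>inv\<close> and \<open>finprod\<close>. An ordering \<open>(a\<^sub>1, \<dots>, a\<^sub>k)\<close> is a list, whose entries are
  indexed from \<open>0\<close>: \<open>a\<^sub>i\<close> is \<open>as ! (i - 1)\<close>.
\<close>

definition partial_sum :: "('a, 'b) monoid_scheme \<Rightarrow> 'a list \<Rightarrow> nat \<Rightarrow> 'a" where
  "partial_sum G as i = finprod G (\<lambda>j. as ! j) {..<i}"

definition weak_sequencing ::
  "('a, 'b) monoid_scheme \<Rightarrow> nat \<Rightarrow> 'a set \<Rightarrow> 'a list \<Rightarrow> bool" where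
  "weak_sequencing G t A as \<longleftrightarrow>
     distinct as \<and> set as = A \<and>
     (\<forall>i\<in>{0..card A}. \<forall>j\<in>{0..card A}.
        i \<noteq> j \<and> \<bar>int i - int j\<bar> \<le> int t \<longrightarrow> partial_sum G as i \<noteq> partial_sum G as j)"

definition weak_sequenceable :: "('a, 'b) monoid_scheme \<Rightarrow> nat \<Rightarrow> 'a set \<Rightarrow> bool" where
  "weak_sequenceable G t A \<longleftrightarrow> (\<exists>as. weak_sequencing G t A as)"

end

theory Submission
  imports Defs "HOL-Combinatorics.Permutations" "HOL-Library.Multiset"
begin

text \<open>
  Sums of one or two consecutive elements never vanish, so only windows of length 3 to 7 matter.
  Some middle elements are placed greedily, and the \<open>h\<close> remaining ones are distributed at
  both ends by the polynomial method. Every window sum is then an affine form in the free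
  positions. If these forms, padded to \<open>h(h - 1)/2\<close> of them, have product \<open>Q\<close>, then the
  alternating sum of \<open>Q\<close> over all arrangements of the free elements \<open>b\<^sub>0, \<dots>, b\<^bsub>h-1\<^esub>\<close> equals
  \<open>c\<close> times the Vandermonde determinant of \<open>b\<close>, where the integer \<open>c\<close> depends only on the linear
  parts of the forms. If \<open>p\<close> does not divide \<open>c\<close>, some arrangement makes all windows nonzero.
  The integer \<open>c\<close> is computed by Pieri's rule for multiplying an alternant by a power sum of
  degree one. For \<open>k \<ge> 17\<close> elements the windows meeting the two ends do not interact, and the
  same shapes serve for all sizes; the sizes from 4 to 16 are treated one by one. As \<open>2k < p\<close>, it is enough
  that the values of \<open>c\<close> found for a given size have no large common prime factor.
\<close>

section \<open>Alternating sums of products of affine forms\<close>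

definition alternator :: "nat \<Rightarrow> (nat \<Rightarrow> int) \<Rightarrow> ((nat \<Rightarrow> int) \<Rightarrow> int) \<Rightarrow> int" where
  "alternator h b f = (\<Sum>\<sigma> | \<sigma> permutes {..<h}. sign \<sigma> * f (b \<circ> \<sigma>))"

definition affine :: "(nat \<Rightarrow> int) \<Rightarrow> nat \<times> nat \<times> int \<Rightarrow> int" where
  "affine x = (\<lambda>(l, r, c). (\<Sum>i\<in>{l..<r}. x i) + c)"

definition monomial :: "nat \<Rightarrow> (nat \<Rightarrow> nat) \<Rightarrow> (nat \<Rightarrow> int) \<Rightarrow> int" where
  "monomial h e x = (\<Prod>i<h. x i ^ e i)"

text \<open>The monomial is carried along so that the affine factors can be multiplied out one at a
  time, by induction on \<open>G\<close>.\<close>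

definition alt_term :: "nat \<Rightarrow> (nat \<Rightarrow> int) \<Rightarrow> (nat \<Rightarrow> nat) \<Rightarrow> (nat \<times> nat \<times> int) multiset \<Rightarrow> int" where
  "alt_term h b e G = alternator h b (\<lambda>x. monomial h e x * (\<Prod>g\<in>#G. affine x g))"

lemma alternator_add:
  "alternator h b (\<lambda>x. f x + g x) = alternator h b f + alternator h b g"
  by (simp add: alternator_def algebra_simps sum.distrib)

lemma alternator_scale: "alternator h b (\<lambda>x. c * f x) = c * alternator h b f"
  by (simp add: alternator_def sum_distrib_left mult.left_commute)

lemma alternator_sum:
  "alternator h b (\<lambda>x. \<Sum>i\<in>I. f i x) = (\<Sum>i\<in>I. alternator h b (f i))"
  unfolding alternator_def sum_distrib_left by (rule sum.swap)

text \<open>Composition with the transposition preserves the values of \<open>f\<close> and reverses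
  all signs, so the sum equals its own negative.\<close>

lemma alternator_eq_0:
  assumes "i < h" "j < h" "i \<noteq> j" and sym: "\<And>x. f (x \<circ> transpose i j) = f x"
  shows "alternator h b f = 0"
proof -
  let ?P = "{\<sigma>. \<sigma> permutes {..<h}}" and ?\<tau> = "transpose i j"
  have \<tau>: "?\<tau> permutes {..<h}"
    using assms by (intro permutes_swap_id) auto
  have bij: "bij_betw (\<lambda>\<sigma>. \<sigma> \<circ> ?\<tau>) ?P ?P"
    by (rule bij_betwI[where g = "\<lambda>\<sigma>. \<sigma> \<circ> ?\<tau>"])
      (use \<tau> in \<open>auto simp: permutes_compose comp_assoc\<close>)
  have "alternator h b f = (\<Sum>\<sigma>\<in>?P. sign (\<sigma> \<circ> ?\<tau>) * f (b \<circ> (\<sigma> \<circ> ?\<tau>)))"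
    unfolding alternator_def by (rule sum.reindex_bij_betw[OF bij, symmetric])
  also have "\<dots> = (\<Sum>\<sigma>\<in>?P. - (sign \<sigma> * f (b \<circ> \<sigma>)))"
  proof (rule sum.cong[OF refl])
    fix \<sigma> assume "\<sigma> \<in> ?P"
    then have "permutation \<sigma>" "permutation ?\<tau>"
      using \<tau> by (auto simp: permutation_permutes)
    then have "sign (\<sigma> \<circ> ?\<tau>) = - sign \<sigma>"
      using assms(3) by (simp add: sign_compose sign_swap_id)
    then show "sign (\<sigma> \<circ> ?\<tau>) * f (b \<circ> (\<sigma> \<circ> ?\<tau>)) = - (sign \<sigma> * f (b \<circ> \<sigma>))"
      using sym[of "b \<circ> \<sigma>"] by (simp add: comp_assoc)
  qed
  finally show ?thesis by (simp add: alternator_def sum_negf)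
qed

lemma monomial_upd:
  assumes "i < h" shows "monomial h (e(i := Suc (e i))) x = x i * monomial h e x"
proof -
  have "monomial h (e(i := Suc (e i))) x = x i ^ Suc (e i) * (\<Prod>j\<in>{..<h} - {i}. x j ^ e j)"
    using assms by (simp add: monomial_def prod.remove[of _ i])
  then show ?thesis using assms by (simp add: monomial_def prod.remove[of _ i] mult.assoc)
qed

lemma monomial_transpose:
  assumes "i < h" "j < h" "e i = e j"
  shows "monomial h e (x \<circ> transpose i j) = monomial h e x"
proof -
  have "(\<Prod>l<h. x l ^ e l) = (\<Prod>l<h. x (transpose i j l) ^ e (transpose i j l))"
    using assms by (intro prod.permute[unfolded comp_def, of "transpose i j" _ "\<lambda>l. x l ^ e l"] permutes_swap_id) auto
  also have "\<dots> = (\<Prod>l<h. x (transpose i j l) ^ e l)"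
    using assms(3) by (intro prod.cong refl) (auto simp: transpose_def)
  finally show ?thesis by (simp add: monomial_def)
qed

lemma affine_transpose:
  assumes "i \<in> {l..<r} \<longleftrightarrow> j \<in> {l..<r}"
  shows "affine (x \<circ> transpose i j) (l, r, c) = affine x (l, r, c)"
proof -
  have "transpose i j permutes {l..<r} \<or> (\<forall>m\<in>{l..<r}. transpose i j m = m)"
  proof (cases "i \<in> {l..<r}")
    case True then show ?thesis using assms by (intro disjI1 permutes_swap_id) auto
  next
    case False then show ?thesis using assms by (auto simp: transpose_def)
  qed
  then have "(\<Sum>m\<in>{l..<r}. x (transpose i j m)) = (\<Sum>m\<in>{l..<r}. x m)"
    using sum.permute[of "transpose i j" "{l..<r}" x] by (auto simp: comp_def)
  then show ?thesis by (simp add: affine_def)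
qed

lemma alt_term_eq_0_if_equal:
  assumes "i < h" "j < h" "i \<noteq> j" "e i = e j"
    and "\<And>l r c. (l, r, c) \<in># G \<Longrightarrow> i \<in> {l..<r} \<longleftrightarrow> j \<in> {l..<r}"
  shows "alt_term h b e G = 0"
  unfolding alt_term_def
proof (rule alternator_eq_0[OF assms(1-3)])
  fix x
  have "image_mset (affine (x \<circ> transpose i j)) G = image_mset (affine x) G"
    using assms(5) by (intro image_mset_cong) (auto simp: affine_transpose)
  then show "monomial h e (x \<circ> transpose i j) * (\<Prod>g\<in>#G. affine (x \<circ> transpose i j) g) =
      monomial h e x * (\<Prod>g\<in>#G. affine x g)"
    using assms by (simp add: monomial_transpose)
qed

lemma alt_term_add_mset:
  assumes "r \<le> h"
  shows "alt_term h b e (add_mset (l, r, c) G) =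
    (\<Sum>i\<in>{l..<r}. alt_term h b (e(i := Suc (e i))) G) + c * alt_term h b e G"
proof -
  have "monomial h e x * (\<Prod>g\<in>#add_mset (l, r, c) G. affine x g) =
      (\<Sum>i\<in>{l..<r}. monomial h (e(i := Suc (e i))) x * (\<Prod>g\<in>#G. affine x g)) +
      c * (monomial h e x * (\<Prod>g\<in>#G. affine x g))" for x
    using assms by (simp add: affine_def monomial_upd algebra_simps sum_distrib_left sum_distrib_right)
  then show ?thesis
    by (simp add: alt_term_def alternator_add alternator_sum alternator_scale)
qed

section \<open>Vanishing in low degree and for large exponents\<close>

lemma sum_upd_Suc:
  assumes "i < h" shows "sum (e(i := Suc (e i))) {..<h} = Suc (sum e {..<(h::nat)})"
  using assms by (simp add: sum.remove[of _ i])

lemma sum_lessThan_le_sum: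
  fixes S :: "nat set" assumes "finite S" shows "\<Sum>{..<card S} \<le> \<Sum>S"
  using assms
proof (induction "card S" arbitrary: S)
  case (Suc n)
  let ?m = "Max S"
  have "S \<noteq> {}" using Suc.hyps(2) by auto
  then have S: "S \<noteq> {}" "?m \<in> S" using Suc.prems by auto
  have "S \<subseteq> {..?m}" using Suc.prems by auto
  from card_mono[OF _ this] have "n \<le> ?m" using Suc.hyps(2) by simp
  moreover have "card (S - {?m}) = n"
    using S Suc.prems by (simp flip: Suc.hyps(2))
  then have "\<Sum>{..<n} \<le> \<Sum>(S - {?m})"
    using Suc.hyps(1)[of "S - {?m}"] Suc.prems by simp
  moreover have "\<Sum>S = ?m + \<Sum>(S - {?m})"
    using S Suc.prems sum.remove[of S ?m "\<lambda>x. x"] by simp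
  moreover have "\<Sum>{..<card S} = n + \<Sum>{..<n}"
    by (simp flip: Suc.hyps(2) add: lessThan_Suc)
  ultimately show ?case by linarith
qed simp

text \<open>Multiplying out leaves monomials of degree below \<open>0 + 1 + ... + (h - 1)\<close>,
  the least sum of \<open>h\<close> distinct exponents, so two exponents coincide in each of
  them.\<close>

lemma alt_term_low_degree:
  assumes "sum e {..<h} + size G < h choose 2" and "\<And>l r c. (l, r, c) \<in># G \<Longrightarrow> r \<le> h"
  shows "alt_term h b e G = 0"
  using assms
proof (induction G arbitrary: e)
  case empty
  have "\<not> inj_on e {..<h}"
  proof
    assume "inj_on e {..<h}"
    then have "card (e ` {..<h}) = h" "\<Sum>(e ` {..<h}) = sum e {..<h}"
      by (simp_all add: card_image sum.reindex)
    with sum_lessThan_le_sum[of "e ` {..<h}"] have "\<Sum>{..<h} \<le> sum e {..<h}" by simp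
    then show False using empty.prems(1)
      by (simp add: choose_two lessThan_atLeast0 Sum_Ico_nat)
  qed
  then obtain i j where "i < h" "j < h" "i \<noteq> j" "e i = e j" by (auto simp: inj_on_def)
  then show ?case by (intro alt_term_eq_0_if_equal[of i h j]) auto
next
  case (add g G)
  obtain l r c where g: "g = (l, r, c)" by (cases g)
  have "r \<le> h" using add.prems g by auto
  moreover have "alt_term h b (e(i := Suc (e i))) G = 0" if "i \<in> {l..<r}" for i
    by (rule add.IH) (use that add.prems \<open>r \<le> h\<close> in \<open>auto simp: sum_upd_Suc simp del: fun_upd_apply\<close>)
  moreover have "alt_term h b e G = 0" by (rule add.IH) (use add.prems in auto)
  ultimately show ?case by (simp add: g alt_term_add_mset)
qed

text \<open>If the exponents were distinct, those other than \<open>e i\<close> would sum to at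
  least \<open>0 + ... + (h - 2)\<close>; together with \<open>e i\<close> they exceed the degree
  bound.\<close>

lemma alt_term_large_exponent:
  assumes "sum e {..<h} + size G \<le> h choose 2" and "\<And>l r c. (l, r, c) \<in># G \<Longrightarrow> r \<le> h"
    and "i < h" "h \<le> e i"
  shows "alt_term h b e G = 0"
  using assms
proof (induction G arbitrary: e)
  case empty
  have "\<not> inj_on e {..<h}"
  proof
    assume inj: "inj_on e {..<h}"
    let ?S = "e ` ({..<h} - {i})"
    have "inj_on e ({..<h} - {i})" using inj by (rule inj_on_subset) auto
    then have "card ?S = h - 1" "\<Sum>?S = sum e ({..<h} - {i})"
      using empty.prems(3) by (simp_all add: card_image sum.reindex)
    with sum_lessThan_le_sum[of ?S] have "\<Sum>{..<h - 1} \<le> sum e ({..<h} - {i})" by simp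
    then have "\<Sum>{..<h - 1} + h \<le> sum e {..<h}"
      using empty.prems(3,4) by (simp add: sum.remove)
    moreover have "\<Sum>{..<h} = \<Sum>{..<h - 1} + (h - 1)"
      using empty.prems(3) by (cases h) (auto simp: lessThan_Suc)
    ultimately show False using empty.prems(1,3)
      by (simp add: choose_two lessThan_atLeast0 Sum_Ico_nat)
  qed
  then obtain i j where "i < h" "j < h" "i \<noteq> j" "e i = e j" by (auto simp: inj_on_def)
  then show ?case by (intro alt_term_eq_0_if_equal[of i h j]) auto
next
  case (add g G)
  obtain l r c where g: "g = (l, r, c)" by (cases g)
  have "r \<le> h" using add.prems g by auto
  moreover have "alt_term h b (e(j := Suc (e j))) G = 0" if "j \<in> {l..<r}" for j
  proof (rule add.IH)
    show "sum (e(j := Suc (e j))) {..<h} + size G \<le> h choose 2"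
      using that add.prems(1) \<open>r \<le> h\<close> by (simp add: sum_upd_Suc del: fun_upd_apply)
  qed (use add.prems in \<open>auto simp: le_SucI\<close>)
  moreover have "alt_term h b e G = 0" by (rule add.IH) (use add.prems in auto)
  ultimately show ?case by (simp add: g alt_term_add_mset)
qed

text \<open>Choosing the constant in some factor lowers the degree below \<open>h choose 2\<close>,
  and such terms vanish by \<open>alt_term_low_degree\<close>.\<close>

lemma alt_term_constants:
  assumes "sum e {..<h} + size G = h choose 2" and "\<And>l r c. (l, r, c) \<in># G \<Longrightarrow> r \<le> h"
  shows "alt_term h b e G = alt_term h b e (image_mset (\<lambda>(l, r, c). (l, r, 0)) G)"
  using assms
proof (induction G arbitrary: e)
  case (add g G)
  obtain l r c where g: "g = (l, r, c)" by (cases g)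
  have "r \<le> h" using add.prems g by auto
  moreover have "alt_term h b (e(j := Suc (e j))) G =
      alt_term h b (e(j := Suc (e j))) (image_mset (\<lambda>(l, r, c). (l, r, 0)) G)" if "j \<in> {l..<r}" for j
    by (rule add.IH) (use that add.prems \<open>r \<le> h\<close> in \<open>auto simp: sum_upd_Suc simp del: fun_upd_apply\<close>)
  moreover have "alt_term h b e G = 0" by (rule alt_term_low_degree) (use add.prems in auto)
  ultimately show ?case by (simp add: g alt_term_add_mset)
qed simp

definition alt_staircase :: "nat \<Rightarrow> (nat \<Rightarrow> int) \<Rightarrow> int" where
  "alt_staircase h b = alt_term h b (\<lambda>i. h - 1 - i) {#}"

lemma alt_term_powers:
  assumes "m \<le> h"
  shows "alt_term h b e ((\<Sum>i<m. replicate_mset (n i) (i, Suc i, 0)) + G) =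
    alt_term h b (\<lambda>i. if i < m then e i + n i else e i) G"
proof -
  have *: "alt_term h b e (replicate_mset k (i, Suc i, 0) + G) = alt_term h b (e(i := e i + k)) G"
    if "i < h" for i k e G
  proof (induction k arbitrary: e)
    case (Suc k)
    have "(e(i := Suc (e i)))(i := (e(i := Suc (e i))) i + k) = e(i := e i + Suc k)" by auto
    with Suc[of "e(i := Suc (e i))"] show ?case
      using that by (simp add: alt_term_add_mset del: fun_upd_apply)
  qed simp
  show ?thesis using assms
  proof (induction m arbitrary: G)
    case (Suc m)
    have "alt_term h b e ((\<Sum>i<Suc m. replicate_mset (n i) (i, Suc i, 0)) + G) =
       alt_term h b e ((\<Sum>i<m. replicate_mset (n i) (i, Suc i, 0)) + (replicate_mset (n m) (m, Suc m, 0) + G))"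
      by (simp add: ac_simps)
    also have "\<dots> = alt_term h b ((\<lambda>i. if i < m then e i + n i else e i)(m := e m + n m)) G"
      using Suc.prems by (subst Suc.IH) (auto simp: *)
    also have "(\<lambda>i. if i < m then e i + n i else e i)(m := e m + n m) =
        (\<lambda>i. if i < Suc m then e i + n i else e i)" by (auto simp: fun_eq_iff less_Suc_eq)
    finally show ?case .
  qed simp
qed

lemma sum_staircase: "(\<Sum>i<h. h - 1 - i) = h choose 2"
  using sum.nat_diff_reindex[of "\<lambda>i. i" h]
  by (simp add: choose_two lessThan_atLeast0 Sum_Ico_nat)

text \<open>
  Among the products of the forms \<open>x\<^sub>i - b\<^sub>j\<close> for \<open>i < j\<close>, only the identical rearrangement of \<open>b\<close>
  survives; this evaluates the Vandermonde determinant.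
\<close>

lemma alt_staircase_eq: "alt_staircase h b = (\<Prod>i<h. \<Prod>j\<in>{i<..<h}. b i - b j)"
proof -
  define G where "G = (\<Sum>i<h. image_mset (\<lambda>j. (i, Suc i, - b j)) (mset_set {i<..<h}))"
  have G: "r \<le> h" if "(l, r, c) \<in># G" for l r c
    using that by (auto simp: G_def set_mset_sum)
  have size: "size G = h choose 2"
    by (simp add: G_def sum_staircase[symmetric])
  have image: "image_mset f (\<Sum>i<n. N i) = (\<Sum>i<n. image_mset f (N i))"
    for f :: "nat \<times> nat \<times> int \<Rightarrow> 'c" and N and n :: nat
    by (induction n) auto
  \<comment> \<open>Each \<open>x i\<close> occurs once for every \<open>j > i\<close>, so the
    linear parts multiply to the staircase monomial.\<close>
  have lin: "image_mset (\<lambda>(l, r, c). (l, r, 0)) G = (\<Sum>i<h. replicate_mset (h - 1 - i) (i, Suc i, 0::int))"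
    unfolding G_def by (simp add: image multiset.map_comp comp_def image_mset_const_eq)
  have "alt_term h b (\<lambda>_. 0) G = alt_term h b (\<lambda>_. 0) (\<Sum>i<h. replicate_mset (h - 1 - i) (i, Suc i, 0))"
    by (subst alt_term_constants) (use G size lin in auto)
  also have "\<dots> = alt_term h b (\<lambda>i. if i < h then 0 + (h - 1 - i) else 0) {#}"
    using alt_term_powers[of h h b "\<lambda>_. 0" "\<lambda>i. h - 1 - i" "{#}"] by simp
  also have "(\<lambda>i. if i < h then 0 + (h - 1 - i) else 0) = (\<lambda>i. h - 1 - i)" by auto
  finally have "alt_staircase h b = alt_term h b (\<lambda>_. 0) G" by (simp add: alt_staircase_def)
  also have "\<dots> = (\<Sum>\<sigma> | \<sigma> permutes {..<h}. sign \<sigma> * (\<Prod>i<h. \<Prod>j\<in>{i<..<h}. b (\<sigma> i) - b j))"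
  proof -
    have prod: "prod_mset (\<Sum>i<n. N i) = (\<Prod>i<n. prod_mset (N i))" for N :: "nat \<Rightarrow> int multiset" and n :: nat
      by (induction n) auto
    have "(\<Prod>g\<in>#G. affine x g) = (\<Prod>i<h. \<Prod>j\<in>{i<..<h}. x i - b j)" for x
      unfolding G_def
      by (simp add: image prod affine_def multiset.map_comp comp_def prod_unfold_prod_mset)
    then show ?thesis by (simp add: alt_term_def alternator_def monomial_def)
  qed
  also have "\<dots> = (\<Sum>\<sigma>\<in>{id}. sign \<sigma> * (\<Prod>i<h. \<Prod>j\<in>{i<..<h}. b (\<sigma> i) - b j))"
  proof (rule sum.mono_neutral_right)
    show "\<forall>\<sigma>\<in>{\<sigma>. \<sigma> permutes {..<h}} - {id}. sign \<sigma> * (\<Prod>i<h. \<Prod>j\<in>{i<..<h}. b (\<sigma> i) - b j) = 0"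
    proof
      fix \<sigma> assume \<sigma>: "\<sigma> \<in> {\<sigma>. \<sigma> permutes {..<h}} - {id}"
      \<comment> \<open>A permutation other than the identity moves some \<open>i\<close> up to
        \<open>j = \<sigma> i\<close>, and then the factor \<open>b (\<sigma> i) - b j\<close> is
        zero.\<close>
      then have "\<not> (\<forall>i\<in>{..<h}. \<sigma> i \<le> i)"
        using permutes_natset_le[of \<sigma> "{..<h}"] by auto
      then obtain i where "i < h" "\<sigma> i > i" by (auto simp: not_le)
      moreover have "\<sigma> i < h" using \<sigma> \<open>i < h\<close> permutes_in_image[of \<sigma> "{..<h}" i] by auto
      ultimately have "\<exists>j\<in>{i<..<h}. b (\<sigma> i) - b j = 0"
        by (intro bexI[of _ "\<sigma> i"]) auto
      then have "(\<Prod>j\<in>{i<..<h}. b (\<sigma> i) - b j) = 0"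
        by (rule prod_zero[rotated]) simp
      then have "(\<Prod>i<h. \<Prod>j\<in>{i<..<h}. b (\<sigma> i) - b j) = 0"
        using \<open>i < h\<close> by (intro prod_zero[OF finite_lessThan]) (rule bexI[of _ i], auto)
      then show "sign \<sigma> * (\<Prod>i<h. \<Prod>j\<in>{i<..<h}. b (\<sigma> i) - b j) = 0" by simp
    qed
  qed (auto simp: finite_permutations permutes_id)
  finally show ?thesis by simp
qed

section \<open>Pieri's rule on trees of exponent sets\<close>

text \<open>
  A tree is an integer combination of sets of exponents: below a node \<open>Bit s t\<close> at depth \<open>i\<close>, the
  exponent \<open>i\<close> is absent in \<open>s\<close> and present in \<open>t\<close>. A set stands for the monomial that gives its
  elements, in decreasing order, to \<open>x\<^sub>0, x\<^sub>1, \<dots>\<close>. A factor \<open>x\<^sub>r + \<dots> + x\<^bsub>q-1\<^esub>\<close> is split as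
  \<open>y\<^sub>q - y\<^sub>r\<close> with \<open>y\<^sub>q = x\<^sub>0 + \<dots> + x\<^bsub>q-1\<^esub>\<close>, and the multiplication by \<open>y\<^sub>q\<close> is postponed
  until \<open>q\<close> variables are present: in a node \<open>Defer s t\<close> of the layer of \<open>q\<close>, the part \<open>t\<close> still
  has to be multiplied by \<open>y\<^sub>q\<close>.
\<close>

datatype alt_tree = Null | Coeff int | Bit alt_tree alt_tree | Defer alt_tree alt_tree

fun bit_node :: "alt_tree \<Rightarrow> alt_tree \<Rightarrow> alt_tree" where
  "bit_node Null Null = Null"
| "bit_node s t = Bit s t"

fun tree_add :: "alt_tree \<Rightarrow> alt_tree \<Rightarrow> alt_tree" where
  "tree_add Null t = t"
| "tree_add t Null = t"
| "tree_add (Coeff x) (Coeff y) = Coeff (x + y)"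
| "tree_add (Bit s t) (Bit s' t') = Bit (tree_add s s') (tree_add t t')"
| "tree_add (Defer s t) (Defer s' t') = Defer (tree_add s s') (tree_add t t')"
| "tree_add _ _ = Null"

fun tree_neg :: "alt_tree \<Rightarrow> alt_tree" where
  "tree_neg Null = Null"
| "tree_neg (Coeff x) = Coeff (- x)"
| "tree_neg (Bit s t) = Bit (tree_neg s) (tree_neg t)"
| "tree_neg (Defer s t) = Defer (tree_neg s) (tree_neg t)"

text \<open>Applied below a node whose exponent \<open>i\<close> is being raised to
  \<open>i + 1\<close>: sets already containing \<open>i + 1\<close> are dropped, since a repeated
  exponent gives zero. At a leaf the raised exponent would reach \<open>h\<close>.\<close>

fun carry :: "alt_tree \<Rightarrow> alt_tree" where
  "carry (Bit s t) = bit_node Null s"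
| "carry _ = Null"

fun tree_raise :: "alt_tree \<Rightarrow> alt_tree" where
  "tree_raise (Bit s t) = bit_node (tree_add (tree_raise s) (carry t)) (tree_raise t)"
| "tree_raise (Defer s t) = Defer (tree_raise s) (tree_raise t)"
| "tree_raise _ = Null"

text \<open>A new variable enters with exponent 0, so sets that already contain 0 are
  dropped.\<close>

fun tree_insert :: "alt_tree \<Rightarrow> alt_tree" where
  "tree_insert (Bit s t) = bit_node Null s"
| "tree_insert (Defer s t) = Defer (tree_insert s) (tree_insert t)"
| "tree_insert _ = Null"

fun tree_collect :: "alt_tree \<Rightarrow> alt_tree" where
  "tree_collect (Defer s t) = tree_add s (tree_raise (tree_collect t))"
| "tree_collect t = t"

fun tree_defer :: "nat \<Rightarrow> alt_tree \<Rightarrow> alt_tree" where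
  "tree_defer 0 t = Defer Null t"
| "tree_defer (Suc j) (Defer s t) = Defer (tree_defer j s) (tree_defer (Suc j) t)"
| "tree_defer (Suc j) _ = Null"

text \<open>Linear extension of \<open>F\<close> from exponent words to trees; appending on the
  right makes the words decreasing.\<close>

fun tree_sum :: "(nat list \<Rightarrow> int) \<Rightarrow> nat \<Rightarrow> alt_tree \<Rightarrow> int" where
  "tree_sum F i (Coeff c) = c * F []"
| "tree_sum F i (Bit s t) = tree_sum F (Suc i) s + tree_sum (\<lambda>d. F (d @ [i])) (Suc i) t"
| "tree_sum F i _ = 0"

fun bit_tree :: "nat \<Rightarrow> alt_tree \<Rightarrow> bool" where
  "bit_tree n Null \<longleftrightarrow> True"
| "bit_tree n (Coeff c) \<longleftrightarrow> n = 0"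
| "bit_tree n (Bit s t) \<longleftrightarrow> n > 0 \<and> bit_tree (n - 1) s \<and> bit_tree (n - 1) t"
| "bit_tree n (Defer s t) \<longleftrightarrow> False"

section \<open>Trees without postponed factors\<close>

lemma bit_tree_bit_node [simp]: "bit_tree n (bit_node s t) \<longleftrightarrow> bit_tree n (Bit s t) \<or> s = Null \<and> t = Null"
  by (cases "(s, t)" rule: bit_node.cases) auto

lemma tree_sum_bit_node [simp]: "tree_sum F i (bit_node s t) = tree_sum F i (Bit s t)"
  by (cases "(s, t)" rule: bit_node.cases) auto

lemma tree_sum_zero [simp]: "tree_sum (\<lambda>_. 0) i t = 0"
  by (induction t arbitrary: i) auto

lemma tree_sum_fun_add: "tree_sum (\<lambda>d. F d + F' d) i t = tree_sum F i t + tree_sum F' i t"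
  by (induction t arbitrary: i F F') (auto simp: algebra_simps)

lemma tree_sum_fun_diff: "tree_sum (\<lambda>d. F d - F' d) i t = tree_sum F i t - tree_sum F' i t"
  by (induction t arbitrary: i F F') (auto simp: algebra_simps)

lemma bit_tree_add: "bit_tree n s \<Longrightarrow> bit_tree n t \<Longrightarrow> bit_tree n (tree_add s t)"
  by (induction s t arbitrary: n rule: tree_add.induct) auto

lemma tree_sum_add:
  "bit_tree n s \<Longrightarrow> bit_tree n t \<Longrightarrow> tree_sum F i (tree_add s t) = tree_sum F i s + tree_sum F i t"
  by (induction s t arbitrary: n F i rule: tree_add.induct) (auto simp: algebra_simps)

lemma bit_tree_neg: "bit_tree n t \<Longrightarrow> bit_tree n (tree_neg t)"
  by (induction t arbitrary: n) auto

lemma tree_sum_neg: "tree_sum F i (tree_neg t) = - tree_sum F i t"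
  by (induction t arbitrary: F i) auto

lemma bit_tree_carry: "bit_tree n t \<Longrightarrow> bit_tree n (carry t)"
  by (cases t) auto

lemma bit_tree_raise: "bit_tree n t \<Longrightarrow> bit_tree n (tree_raise t)"
  by (induction t arbitrary: n) (auto intro: bit_tree_add bit_tree_carry)

lemma bit_tree_insert: "bit_tree n t \<Longrightarrow> bit_tree n (tree_insert t)"
  by (cases t) auto

text \<open>The two properties of alternants that justify the sets dropped by \<open>carry\<close>
  and \<open>tree_insert\<close>.\<close>

definition vanishing :: "nat \<Rightarrow> (nat list \<Rightarrow> int) \<Rightarrow> bool" where
  "vanishing h F \<longleftrightarrow> (\<forall>u v e. F (u @ e # e # v) = 0) \<and> (\<forall>d. (\<exists>e\<in>set d. h \<le> e) \<longrightarrow> F d = 0)"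

lemma vanishing_append: "vanishing h F \<Longrightarrow> vanishing h (\<lambda>d. F (d @ v))"
  unfolding vanishing_def by (metis Un_iff append.assoc append_Cons set_append)

lemma tree_sum_carry:
  assumes "vanishing h F" "bit_tree n t" "Suc i + n = h"
  shows "tree_sum (\<lambda>d. F (d @ [Suc i])) (Suc i) t = tree_sum F (Suc i) (carry t)"
proof (cases t)
  case (Bit s t')
  have "F (d @ [Suc i, Suc i]) = 0" for d
    using assms(1) by (auto simp: vanishing_def)
  then show ?thesis using Bit by simp
next
  case (Coeff c)
  then have "F [Suc i] = 0" using assms by (auto simp: vanishing_def)
  then show ?thesis using Coeff by simp
qed (use assms in auto)

text \<open>Pieri's rule in degree one: either the smallest remaining exponent \<open>i\<close> is
  raised, which \<open>carry\<close> handles, or a larger one is, which is the recursion.\<close>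

lemma tree_sum_raise:
  assumes "vanishing h F" "bit_tree n t" "i + n = h"
  shows "tree_sum (\<lambda>d. \<Sum>l<length d. F (d[l := Suc (d ! l)])) i t = tree_sum F i (tree_raise t)"
  using assms
proof (induction t arbitrary: F n i)
  case (Bit s t)
  let ?R = "\<lambda>F d. \<Sum>l<length d. F (d[l := Suc (d ! l)])" and ?F = "\<lambda>d. F (d @ [i])"
  have R: "?R F (d @ [i]) = ?R ?F d + F (d @ [Suc i])" for d
    by (simp add: nth_append list_update_append)
  from Bit.prems have n: "n > 0" "bit_tree (n - 1) s" "bit_tree (n - 1) t" "Suc i + (n - 1) = h" by auto
  have "tree_sum (?R F) i (Bit s t) =
      tree_sum (?R F) (Suc i) s + tree_sum (?R ?F) (Suc i) t + tree_sum (\<lambda>d. F (d @ [Suc i])) (Suc i) t"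
    by (simp only: tree_sum.simps R tree_sum_fun_add add.assoc)
  also have "\<dots> = tree_sum F (Suc i) (tree_raise s) + tree_sum ?F (Suc i) (tree_raise t)
      + tree_sum F (Suc i) (carry t)"
    using Bit.IH(1)[of F "n - 1" "Suc i"] Bit.IH(2)[of ?F "n - 1" "Suc i"] Bit.prems(1) n
      tree_sum_carry[of h F "n - 1" t i] vanishing_append[of h F "[i]"] by simp
  also have "\<dots> = tree_sum F i (tree_raise (Bit s t))"
    using n by (simp add: tree_sum_add[of "n - 1"] bit_tree_raise bit_tree_carry)
  finally show ?case .
qed auto

lemma tree_sum_insert:
  assumes "vanishing h F" "bit_tree h t" "h > 0"
  shows "tree_sum (\<lambda>d. F (d @ [0])) 0 t = tree_sum F 0 (tree_insert t)"
proof (cases t)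
  case (Bit s t')
  have "F (d @ [0, 0]) = 0" for d
    using assms(1) by (auto simp: vanishing_def)
  then show ?thesis using Bit by simp
qed (use assms in auto)

text \<open>Variables from \<open>r\<close> on have exponent 0. The value 0 for a wrong length or
  degree makes \<open>vanishing\<close> hold for all words, as
  \<open>alt_term_large_exponent\<close> needs the degree bound.\<close>

definition alt_word :: "nat \<Rightarrow> (nat \<Rightarrow> int) \<Rightarrow> nat \<Rightarrow> (nat \<times> nat \<times> int) multiset \<Rightarrow> nat list \<Rightarrow> int" where
  "alt_word h b r G d =
    (if length d = r \<and> sum_list d + size G = h choose 2
     then alt_term h b (\<lambda>i. if i < r then d ! i else 0) G else 0)"

text \<open>Each form contains all of the first \<open>r\<close> variables or none of them, so equal
  exponents among these give zero.\<close>

definition admissible :: "nat \<Rightarrow> nat \<Rightarrow> (nat \<times> nat \<times> int) multiset \<Rightarrow> bool" where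
  "admissible h r G \<longleftrightarrow> (\<forall>(l, q, c)\<in>#G. r \<le> q \<and> q \<le> h \<and> (l = 0 \<or> r \<le> l))"

lemma sum_nth_padded:
  assumes "length d \<le> h"
  shows "(\<Sum>i<h. if i < length d then d ! i else 0) = (sum_list d :: nat)"
proof -
  have "(\<Sum>i<h. if i < length d then d ! i else 0) = (\<Sum>i<length d. d ! i)"
    using assms by (intro sum.mono_neutral_cong_right) auto
  then show ?thesis by (simp add: sum_list_sum_nth lessThan_atLeast0)
qed

lemma vanishing_alt_word:
  assumes "admissible h r G" "r \<le> h"
  shows "vanishing h (alt_word h b r G)"
  unfolding vanishing_def
proof (intro conjI allI impI)
  fix u v :: "nat list" and e
  let ?d = "u @ e # e # v"
  have "alt_term h b (\<lambda>i. if i < r then ?d ! i else 0) G = 0" if "length ?d = r"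
    by (rule alt_term_eq_0_if_equal[of "length u" _ "Suc (length u)"])
      (use that assms in \<open>force simp: admissible_def nth_append\<close>)+
  then show "alt_word h b r G ?d = 0" by (simp add: alt_word_def)
next
  fix d assume "\<exists>e\<in>set d. h \<le> e"
  then obtain i where i: "i < length d" "h \<le> d ! i" by (auto simp: in_set_conv_nth)
  have "alt_term h b (\<lambda>i. if i < r then d ! i else 0) G = 0"
    if "length d = r" "sum_list d + size G = h choose 2"
    by (rule alt_term_large_exponent[of _ _ _ i])
      (use that assms i sum_nth_padded[of d h] in \<open>auto simp: admissible_def\<close>)
  then show "alt_word h b r G d = 0" by (simp add: alt_word_def)
qed

lemma alt_word_raise:
  assumes "r \<le> h"
  shows "alt_word h b r (add_mset (0, r, 0) G) d =
    (\<Sum>l<length d. alt_word h b r G (d[l := Suc (d ! l)]))"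
proof (cases "length d = r \<and> Suc (sum_list d + size G) = h choose 2")
  case True
  then have upd: "(\<lambda>i. if i < length d then d ! i else 0)(l := Suc (d ! l)) =
      (\<lambda>i. if i < length d then d[l := Suc (d ! l)] ! i else 0)" if "l < length d" for l
    using that by (auto simp: fun_eq_iff)
  have "sum_list (d[l := Suc (d ! l)]) = Suc (sum_list d)" if "l < r" for l
    using that True member_le_sum_list[of "d ! l" d] by (simp add: sum_list_update)
  then show ?thesis
    using True assms by (auto simp: alt_word_def alt_term_add_mset upd lessThan_atLeast0 intro!: sum.cong)
next
  case False
  have "sum_list (d[l := Suc (d ! l)]) = Suc (sum_list d)" if "l < length d" for l
    using that member_le_sum_list[of "d ! l" d] by (simp add: sum_list_update)
  with False show ?thesis by (auto simp: alt_word_def)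
qed

lemma alt_word_insert: "alt_word h b r G d = alt_word h b (Suc r) G (d @ [0])"
proof -
  have "(\<lambda>i. if i < r then d ! i else 0) = (\<lambda>i. if i < Suc r then (d @ [0]) ! i else 0)"
    if "length d = r" using that by (auto simp: fun_eq_iff nth_append)
  then show ?thesis by (auto simp: alt_word_def)
qed

lemma alt_word_difference:
  assumes "r \<le> q" "q \<le> h"
  shows "alt_word h b r (add_mset (r, q, 0) G) d =
    alt_word h b r (add_mset (0, q, 0) G) d - alt_word h b r (add_mset (0, r, 0) G) d"
proof -
  have "sum f {0..<q} = sum f {0..<r} + sum f {r..<q}" for f :: "nat \<Rightarrow> int"
    using assms by (intro sum.atLeastLessThan_concat[symmetric]) auto
  then show ?thesis using assms by (simp add: alt_word_def alt_term_add_mset)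
qed

section \<open>Trees with layers of postponed factors\<close>

fun layered :: "nat \<Rightarrow> nat \<Rightarrow> alt_tree \<Rightarrow> bool" where
  "layered h 0 t \<longleftrightarrow> bit_tree h t"
| "layered h (Suc n) Null \<longleftrightarrow> True"
| "layered h (Suc n) (Defer s t) \<longleftrightarrow> layered h n s \<and> layered h (Suc n) t"
| "layered h (Suc n) _ \<longleftrightarrow> False"

text \<open>Along \<open>s\<close> the next layer is entered; along \<open>t\<close> one more factor
  \<open>y_q\<close> is pending in the same layer, so nested right branches encode powers of
  \<open>y_q\<close>.\<close>

fun layer_sum ::
  "nat \<Rightarrow> (nat \<Rightarrow> int) \<Rightarrow> nat \<Rightarrow> nat \<Rightarrow> (nat \<times> nat \<times> int) multiset \<Rightarrow> alt_tree \<Rightarrow> int" where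
  "layer_sum h b r q G (Defer s t) = layer_sum h b r (Suc q) G s + layer_sum h b r q (add_mset (0, q, 0) G) t"
| "layer_sum h b r q G t = tree_sum (alt_word h b r G) 0 t"

lemma layer_sum_bit_tree: "bit_tree n t \<Longrightarrow> layer_sum h b r q G t = tree_sum (alt_word h b r G) 0 t"
  by (cases t) auto

lemma layered_Null [simp]: "layered h n Null"
  by (cases n) auto

lemma layered_add: "layered h n s \<Longrightarrow> layered h n t \<Longrightarrow> layered h n (tree_add s t)"
  by (induction s t arbitrary: n rule: tree_add.induct; case_tac n) (auto simp: bit_tree_add)

lemma layer_sum_add:
  "layered h n s \<Longrightarrow> layered h n t \<Longrightarrow>
    layer_sum h b r q G (tree_add s t) = layer_sum h b r q G s + layer_sum h b r q G t"
proof (induction s t arbitrary: n q G rule: tree_add.induct)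
  case (5 s t s' t')
  then show ?case by (cases n) auto
next
  case (4 s t s' t')
  then show ?case by (cases n) (auto simp: tree_sum_add[of "h - 1"])
qed (case_tac n; auto simp: algebra_simps)+

lemma layered_neg: "layered h n t \<Longrightarrow> layered h n (tree_neg t)"
  by (induction t arbitrary: n; case_tac n) (auto simp: bit_tree_neg)

lemma layer_sum_neg: "layer_sum h b r q G (tree_neg t) = - layer_sum h b r q G t"
  by (induction t arbitrary: q G) (auto simp: tree_sum_neg)

lemma layered_raise: "layered h n t \<Longrightarrow> layered h n (tree_raise t)"
  by (induction t arbitrary: n; case_tac n) (auto simp: bit_tree_add bit_tree_raise bit_tree_carry)

text \<open>The pending factors \<open>y_q\<close> have \<open>q \<ge> r\<close> and are symmetric
  in the first \<open>r\<close> variables, so Pieri's rule for \<open>y_r\<close> applies underneath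
  them.\<close>

lemma layer_sum_raise:
  assumes "layered h n t" "admissible h r G" "r \<le> q" "q + n = Suc h" "r \<le> h"
  shows "layer_sum h b r q (add_mset (0, r, 0) G) t = layer_sum h b r q G (tree_raise t)"
  using assms
proof (induction t arbitrary: n q G)
  case (Defer s t)
  then obtain n' where n: "n = Suc n'" by (cases n) auto
  have "admissible h r (add_mset (0, q, 0) G)"
    using Defer.prems n by (auto simp: admissible_def)
  then show ?case
    using Defer.IH(1)[of n' G "Suc q"] Defer.IH(2)[of n "add_mset (0, q, 0) G" q] Defer.prems n
    by (simp add: add_mset_commute)
next
  case (Bit s t)
  then have t: "bit_tree h (Bit s t)" by (cases n) auto
  have "layer_sum h b r q (add_mset (0, r, 0) G) (Bit s t) =
      tree_sum (\<lambda>d. \<Sum>l<length d. alt_word h b r G (d[l := Suc (d ! l)])) 0 (Bit s t)"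
    by (simp only: layer_sum.simps alt_word_raise[OF \<open>r \<le> h\<close>, abs_def])
  also have "\<dots> = tree_sum (alt_word h b r G) 0 (tree_raise (Bit s t))"
    using Bit.prems t by (intro tree_sum_raise[of h _ h] vanishing_alt_word) auto
  finally show ?case using layer_sum_bit_tree[OF bit_tree_raise[OF t]] by simp
qed (auto simp: alt_word_raise)

lemma layered_insert: "layered h n t \<Longrightarrow> layered h n (tree_insert t)"
  by (induction t arbitrary: n; case_tac n) auto

lemma layer_sum_insert:
  assumes "layered h n t" "admissible h (Suc r) G" "Suc r \<le> q" "q + n = Suc h" "Suc r \<le> h"
  shows "layer_sum h b r q G t = layer_sum h b (Suc r) q G (tree_insert t)"
  using assms
proof (induction t arbitrary: n q G)
  case (Defer s t)
  then obtain n' where n: "n = Suc n'" by (cases n) auto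
  have "admissible h (Suc r) (add_mset (0, q, 0) G)"
    using Defer.prems n by (auto simp: admissible_def)
  then show ?case
    using Defer.IH(1)[of n' G "Suc q"] Defer.IH(2)[of n "add_mset (0, q, 0) G" q] Defer.prems n
    by simp
next
  case (Bit s t)
  then have t: "bit_tree h (Bit s t)" by (cases n) auto
  have "layer_sum h b r q G (Bit s t) = tree_sum (\<lambda>d. alt_word h b (Suc r) G (d @ [0])) 0 (Bit s t)"
    by (simp only: layer_sum.simps alt_word_insert[of h b r G, abs_def])
  also have "\<dots> = tree_sum (alt_word h b (Suc r) G) 0 (tree_insert (Bit s t))"
    using Bit.prems t by (intro tree_sum_insert[of h] vanishing_alt_word) auto
  finally show ?case using layer_sum_bit_tree[OF bit_tree_insert[OF t]] by simp
next
  case (Coeff c)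
  then show ?case by (cases n) auto
qed auto

lemma layered_collect:
  "layered h (Suc n) t \<Longrightarrow> layered h n (tree_collect t)"
  by (induction t) (auto simp: layered_add layered_raise)

text \<open>Horner's scheme in \<open>y_r\<close>: each nested right branch is multiplied by
  \<open>y_r\<close> once more, and the layer of \<open>r\<close> disappears.\<close>

lemma layer_sum_collect:
  assumes "layered h (Suc n) t" "admissible h r G" "r + n = h"
  shows "layer_sum h b r r G t = layer_sum h b r (Suc r) G (tree_collect t)"
  using assms
proof (induction t arbitrary: G)
  case (Defer s t)
  have "admissible h r (add_mset (0, r, 0) G)"
    using Defer.prems by (auto simp: admissible_def)
  then have "layer_sum h b r r G (Defer s t) =
      layer_sum h b r (Suc r) G s + layer_sum h b r (Suc r) (add_mset (0, r, 0) G) (tree_collect t)"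
    using Defer.IH(2) Defer.prems by simp
  also have "layer_sum h b r (Suc r) (add_mset (0, r, 0) G) (tree_collect t) =
      layer_sum h b r (Suc r) G (tree_raise (tree_collect t))"
    by (rule layer_sum_raise[of h n]) (use Defer.prems layered_collect[of h n t] in auto)
  finally show ?case
    using layer_sum_add[of h n s "tree_raise (tree_collect t)"] Defer.prems
      layered_raise[OF layered_collect[of h n t]] by simp
qed auto

lemma layered_defer: "layered h n t \<Longrightarrow> j < n \<Longrightarrow> layered h n (tree_defer j t)"
  by (induction j t arbitrary: n rule: tree_defer.induct; case_tac n) auto

lemma layer_sum_defer:
  assumes "layered h n t" "j < n"
  shows "layer_sum h b r q (add_mset (0, q + j, 0) G) t = layer_sum h b r q G (tree_defer j t)"
  using assms
proof (induction j t arbitrary: n q G rule: tree_defer.induct)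
  case (2 j s t)
  then obtain n' where n: "n = Suc n'" by (cases n) auto
  show ?case
    using 2(1)[of n' "Suc q" G] 2(2)[of n q "add_mset (0, q, 0) G"] 2(3,4) n
    by (simp add: add_mset_commute)
next
  case ("3_2" j c)
  then show ?case by (cases n) auto
next
  case ("3_3" j s t)
  then show ?case by (cases n) auto
qed auto

lemma layer_sum_difference:
  assumes "layered h n t" "r \<le> q" "q \<le> h"
  shows "layer_sum h b r m (add_mset (r, q, 0) G) t =
    layer_sum h b r m (add_mset (0, q, 0) G) t - layer_sum h b r m (add_mset (0, r, 0) G) t"
  using assms(1)
proof (induction t arbitrary: n m G)
  case (Defer s t)
  then obtain n' where n: "n = Suc n'" by (cases n) auto
  show ?case
    using Defer.IH(1)[of n' "Suc m" G] Defer.IH(2)[of n m "add_mset (0, m, 0) G"] Defer.prems n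
    by (simp add: add_mset_commute[of _ "(0, m, 0)"])
qed (simp_all only: layer_sum.simps alt_word_difference[OF assms(2,3), abs_def] tree_sum_fun_diff)

text \<open>
  The \<open>r\<close>-th entry \<open>(m, js)\<close> of a program, counted from 1, stands for \<open>m\<close> factors \<open>y\<^sub>r\<close> and
  for the factors \<open>y\<^bsub>r+1+j\<^esub> - y\<^sub>r\<close> with \<open>j\<close> in \<open>js\<close>.
\<close>

fun raise_times :: "nat \<Rightarrow> alt_tree \<Rightarrow> alt_tree" where
  "raise_times 0 t = t"
| "raise_times (Suc n) t = raise_times n (tree_raise t)"

fun tree_differences :: "nat list \<Rightarrow> alt_tree \<Rightarrow> alt_tree" where
  "tree_differences [] t = t"
| "tree_differences (j # js) t = tree_differences js (tree_add (tree_defer j t) (tree_neg (tree_raise t)))"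

fun tree_stages :: "(nat \<times> nat list) list \<Rightarrow> alt_tree \<Rightarrow> alt_tree" where
  "tree_stages [] t = t"
| "tree_stages ((m, js) # ps) t =
    tree_stages ps (tree_differences js (raise_times m (tree_collect (tree_insert t))))"

fun stage_forms :: "nat \<Rightarrow> nat \<times> nat list \<Rightarrow> (nat \<times> nat \<times> int) multiset" where
  "stage_forms r (m, js) = replicate_mset m (0, r, 0) + image_mset (\<lambda>j. (r, Suc r + j, 0)) (mset js)"

fun program_forms :: "nat \<Rightarrow> (nat \<times> nat list) list \<Rightarrow> (nat \<times> nat \<times> int) multiset" where
  "program_forms r [] = {#}"
| "program_forms r (p # ps) = stage_forms r p + program_forms (Suc r) ps"

fun program_valid :: "(nat \<times> nat list) list \<Rightarrow> bool" where
  "program_valid [] \<longleftrightarrow> True"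
| "program_valid ((m, js) # ps) \<longleftrightarrow> (\<forall>j\<in>set js. j < length ps) \<and> program_valid ps"

section \<open>Execution of programs\<close>

lemma admissible_union: "admissible h r (G + G') \<longleftrightarrow> admissible h r G \<and> admissible h r G'"
  by (simp add: admissible_def ball_Un)

lemma admissible_mono: "admissible h r G \<Longrightarrow> r' \<le> r \<Longrightarrow> admissible h r' G"
  by (fastforce simp: admissible_def)

lemma admissible_program_forms:
  "program_valid ps \<Longrightarrow> r + length ps = Suc h \<Longrightarrow> admissible h r (program_forms r ps)"
proof (induction ps arbitrary: r)
  case (Cons p ps)
  obtain m js where p: "p = (m, js)" by (cases p)
  have "admissible h r (stage_forms r p)"
    using Cons.prems p by (auto simp: admissible_def)
  moreover have "admissible h (Suc r) (program_forms (Suc r) ps)"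
    using Cons p by auto
  ultimately show ?case
    by (auto simp: admissible_union intro: admissible_mono)
qed (simp add: admissible_def)

lemma layered_raise_times: "layered h n t \<Longrightarrow> layered h n (raise_times m t)"
  by (induction m arbitrary: t) (auto simp: layered_raise)

lemma layer_sum_raise_times:
  assumes "layered h n t" "admissible h r G" "r \<le> q" "q + n = Suc h" "r \<le> h"
  shows "layer_sum h b r q (replicate_mset m (0, r, 0) + G) t = layer_sum h b r q G (raise_times m t)"
  using assms(1)
proof (induction m arbitrary: t)
  case (Suc m)
  have "admissible h r (replicate_mset m (0, r, 0) + G)"
    using assms by (auto simp: admissible_def)
  then show ?case
    using Suc layer_sum_raise[of h n t r "replicate_mset m (0, r, 0) + G" q b] assms
    by (simp add: layered_raise)
qed simp

lemma layered_differences: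
  "layered h n t \<Longrightarrow> \<forall>j\<in>set js. j < n \<Longrightarrow> layered h n (tree_differences js t)"
  by (induction js arbitrary: t) (auto simp: layered_raise layered_add layered_neg layered_defer)

lemma layer_sum_differences:
  assumes "layered h n t" "admissible h r G" "r + n = h" "\<forall>j\<in>set js. j < n"
  shows "layer_sum h b r (Suc r) (image_mset (\<lambda>j. (r, Suc r + j, 0)) (mset js) + G) t =
    layer_sum h b r (Suc r) G (tree_differences js t)"
  using assms(1,4)
proof (induction js arbitrary: t)
  case (Cons j js)
  let ?G = "image_mset (\<lambda>j. (r, Suc r + j, 0)) (mset js) + G"
  let ?t = "tree_add (tree_defer j t) (tree_neg (tree_raise t))"
  have G: "admissible h r ?G"
    using assms Cons.prems(2) by (auto simp: admissible_def)
  have "layer_sum h b r (Suc r) (add_mset (r, Suc r + j, 0) ?G) t =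
      layer_sum h b r (Suc r) ?G (tree_defer j t) - layer_sum h b r (Suc r) ?G (tree_raise t)"
    using layer_sum_difference[of h n t r "Suc r + j" b "Suc r" ?G] layer_sum_defer[of h n t j b r "Suc r" ?G]
      layer_sum_raise[of h n t r ?G "Suc r" b] Cons.prems assms G by simp
  also have "\<dots> = layer_sum h b r (Suc r) ?G ?t"
    using layer_sum_add[of h n "tree_defer j t" "tree_neg (tree_raise t)"] Cons.prems
    by (simp add: layered_raise layered_neg layered_defer layer_sum_neg)
  also have "\<dots> = layer_sum h b r (Suc r) G (tree_differences js ?t)"
    using Cons.prems by (intro Cons.IH) (auto simp: layered_raise layered_add layered_neg layered_defer)
  finally show ?case by simp
qed simp

text \<open>At each stage one variable enters, the postponed factors of the new prefix sum are
  collected, and then the forms of that stage are consumed. The forms still to come remain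
  admissible.\<close>

lemma layer_sum_stages:
  assumes "layered h (length ps) t" "r + length ps = h" "program_valid ps"
  shows "layer_sum h b r (Suc r) (program_forms (Suc r) ps) t =
      layer_sum h b h (Suc h) {#} (tree_stages ps t) \<and> layered h 0 (tree_stages ps t)"
  using assms
proof (induction ps arbitrary: r t)
  case (Cons p ps)
  obtain m js where p: "p = (m, js)" by (cases p)
  let ?n = "length ps" and ?r = "Suc r"
  let ?t1 = "tree_insert t" let ?t2 = "tree_collect ?t1" let ?t3 = "raise_times m ?t2"
  let ?t4 = "tree_differences js ?t3"
  let ?G = "program_forms (Suc ?r) ps" let ?J = "image_mset (\<lambda>j. (?r, Suc ?r + j, 0)) (mset js)"
  have l: "layered h (Suc ?n) ?t1" "layered h ?n ?t2" "layered h ?n ?t3" "layered h ?n ?t4"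
    using Cons.prems p
    by (auto intro!: layered_insert layered_collect layered_raise_times layered_differences)
  have a: "admissible h ?r (replicate_mset m (0, ?r, 0) + (?J + ?G))"
    using admissible_program_forms[of "p # ps" ?r h] Cons.prems p by (simp add: add.assoc)
  then have a': "admissible h ?r (?J + ?G)" "admissible h ?r ?G" by (auto simp: admissible_union)
  have "layer_sum h b r ?r (program_forms ?r (p # ps)) t =
      layer_sum h b r ?r (replicate_mset m (0, ?r, 0) + (?J + ?G)) t"
    by (simp add: p add.assoc)
  also have "\<dots> = layer_sum h b ?r ?r (replicate_mset m (0, ?r, 0) + (?J + ?G)) ?t1"
    using layer_sum_insert[of h "Suc ?n" t r _ ?r b] a Cons.prems by simp
  also have "\<dots> = layer_sum h b ?r (Suc ?r) (replicate_mset m (0, ?r, 0) + (?J + ?G)) ?t2"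
    using layer_sum_collect[of h ?n ?t1 ?r _ b] a l Cons.prems by simp
  also have "\<dots> = layer_sum h b ?r (Suc ?r) (?J + ?G) ?t3"
    using layer_sum_raise_times[of h ?n ?t2 ?r _ "Suc ?r" b m] a' l Cons.prems by simp
  also have "\<dots> = layer_sum h b ?r (Suc ?r) ?G ?t4"
    using layer_sum_differences[of h ?n ?t3 ?r ?G js b] a' l Cons.prems p by simp
  finally show ?case using Cons.IH[of ?t4 ?r] l Cons.prems p by simp
qed simp

fun zero_tree :: "nat \<Rightarrow> alt_tree" where
  "zero_tree 0 = Coeff 1"
| "zero_tree (Suc n) = Bit (zero_tree n) Null"

fun add_layers :: "nat \<Rightarrow> alt_tree \<Rightarrow> alt_tree" where
  "add_layers 0 t = t"
| "add_layers (Suc n) t = Defer (add_layers n t) Null"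

text \<open>The set \<open>{0, ..., n - 1}\<close> with coefficient \<open>c\<close>. Its word is
  the staircase of exponents, so \<open>c\<close> becomes the factor of the Vandermonde
  determinant.\<close>

fun full_tree :: "nat \<Rightarrow> int \<Rightarrow> alt_tree" where
  "full_tree 0 c = Coeff c"
| "full_tree (Suc n) c = Bit Null (full_tree n c)"

lemma zero_tree: "bit_tree h (zero_tree h)" "tree_sum F i (zero_tree h) = F []"
  by (induction h arbitrary: i) auto

lemma add_layers:
  assumes "bit_tree h t"
  shows "layered h n (add_layers n t)"
    "layer_sum h b r q G (add_layers n t) = tree_sum (alt_word h b r G) 0 t"
  using layer_sum_bit_tree[OF assms] assms by (induction n arbitrary: q) auto

lemma full_tree: "bit_tree n (full_tree n c)" "tree_sum F i (full_tree n c) = c * F (rev [i..<i + n])"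
proof (induction n arbitrary: i F)
  case (Suc n)
  { case 1 show ?case using Suc by simp }
  { case 2 show ?case using Suc(2)[of "\<lambda>d. F (d @ [i])" "Suc i"] by (simp add: upt_rec[of i]) }
qed auto

text \<open>After the constants are removed, the run leads from no variables with all forms pending
  to \<open>h\<close> variables with no form left.\<close>

theorem alt_term_program:
  assumes "length ps = h" "program_valid ps" "size G = h choose 2"
    and G: "image_mset (\<lambda>(l, r, c). (l, r, 0)) G = program_forms 1 ps"
    and run: "tree_stages ps (add_layers h (zero_tree h)) = full_tree h c"
  shows "alt_term h b (\<lambda>_. 0) G = c * alt_staircase h b"
proof -
  let ?P = "program_forms 1 ps"
  have size: "size ?P = h choose 2" using assms(3) arg_cong[OF G, of size] by simp
  have adm: "admissible h 1 ?P"
    using admissible_program_forms[of ps 1 h] assms by simp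
  have le: "r \<le> h" if "(l, r, c) \<in># G" for l r c
  proof -
    have "(l, r, 0) \<in># image_mset (\<lambda>(l, r, c). (l, r, 0 :: int)) G"
      using that by (force simp: image_iff)
    then show ?thesis using adm unfolding G by (auto simp: admissible_def)
  qed
  have "alt_term h b (\<lambda>_. 0) G = alt_term h b (\<lambda>_. 0) ?P"
    using alt_term_constants[of "\<lambda>_. 0" h G b] le assms(3) by (simp add: G)
  also have "\<dots> = alt_word h b 0 ?P []"
    using size by (simp add: alt_word_def)
  also have "\<dots> = layer_sum h b 0 1 ?P (add_layers h (zero_tree h))"
    by (simp add: add_layers zero_tree)
  also have "\<dots> = layer_sum h b h (Suc h) {#} (full_tree h c)"
    using layer_sum_stages[of h ps "add_layers h (zero_tree h)" 0 b] assms
    by (simp add: add_layers zero_tree)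
  also have "\<dots> = c * alt_word h b h {#} (rev [0..<h])"
    by (simp add: layer_sum_bit_tree[OF full_tree(1)] full_tree)
  also have "alt_word h b h {#} (rev [0..<h]) = alt_staircase h b"
  proof -
    have sum: "sum_list (rev [0..<h]) = h choose 2"
      by (simp add: sum_list_rev interv_sum_list_conv_sum_set_nat choose_two Sum_Ico_nat)
    have "alt_term h b (\<lambda>i. if i < h then rev [0..<h] ! i else 0) {#} = alt_term h b (\<lambda>i. h - 1 - i) {#}"
      unfolding alt_term_def monomial_def
      by (intro arg_cong[of _ _ "alternator h b"] ext arg_cong2[of _ _ _ _ "(*)"] prod.cong refl)
        (simp add: rev_nth)
    with sum show ?thesis by (simp add: alt_word_def alt_staircase_def)
  qed
  finally show ?thesis .
qed

text \<open>A form is filed under stage \<open>l\<close>, or under \<open>q\<close> if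
  \<open>l = 0\<close>, as it is then a prefix sum itself. The index \<open>j = q - Suc l\<close>
  solves \<open>q = l + 1 + j\<close>.\<close>

definition program_of :: "nat \<Rightarrow> (nat \<times> nat) list \<Rightarrow> (nat \<times> nat list) list" where
  "program_of h fs = map (\<lambda>r. (length (filter (\<lambda>f. f = (0, r)) fs),
     map (\<lambda>(l, q). q - Suc l) (filter (\<lambda>(l, q). l = r) fs))) [1..<Suc h]"

lemma program_of:
  assumes "\<forall>(l, q)\<in>set fs. l < q \<and> q \<le> h"
  shows "length (program_of h fs) = h" "program_valid (program_of h fs)"
    "program_forms 1 (program_of h fs) = mset (map (\<lambda>(l, q). (l, q, 0)) fs)"
proof -
  let ?P = "\<lambda>r. (length (filter (\<lambda>f. f = (0, r)) fs),
     map (\<lambda>(l, q). q - Suc l) (filter (\<lambda>(l, q). l = r) fs))"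
  let ?st = "\<lambda>(l, q). if l = 0 then q else (l :: nat)"
  let ?lift = "\<lambda>(l, q). (l, q, 0 :: int)"
  show "length (program_of h fs) = h" by (simp add: program_of_def)
  have "program_valid (map ?P [r..<r + n])" if "r + n = Suc h" for r n
    using that
  proof (induction n arbitrary: r)
    case (Suc n)
    have "[r..<r + Suc n] = r # [Suc r..<Suc r + n]" by (simp add: upt_rec[of r])
    moreover have "q - Suc r < n" if "(r, q) \<in> set fs" for q
      using that assms Suc.prems by fastforce
    ultimately show ?case using Suc.IH[of "Suc r"] Suc.prems by auto
  qed simp
  from this[of 1 h] show "program_valid (program_of h fs)" by (simp add: program_of_def)
  have stage: "stage_forms r (?P r) = mset (map ?lift (filter (\<lambda>f. ?st f = r) fs))" if "r > 0" for r
    using assms that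
  proof (induction fs)
    case (Cons f fs)
    obtain l q where f: "f = (l, q)" by (cases f)
    have "l < q" using Cons.prems f by simp
    then show ?case using Cons by (cases "l = 0"; cases "l = r"; cases "q = r") (auto simp: f)
  qed simp
  have "program_forms r (map ?P [r..<r + n]) =
      mset (map ?lift (filter (\<lambda>f. r \<le> ?st f \<and> ?st f < r + n) fs))" if "r > 0" for r n
    using that
  proof (induction n arbitrary: r)
    case 0
    then show ?case by (simp add: filter_empty_conv)
  next
    case (Suc n)
    have upt: "[r..<r + Suc n] = r # [Suc r..<Suc r + n]" by (simp add: upt_rec[of r])
    have "program_forms r (map ?P [r..<r + Suc n]) =
        stage_forms r (?P r) + program_forms (Suc r) (map ?P [Suc r..<Suc r + n])"
      unfolding upt by simp
    also have "\<dots> = mset (map ?lift (filter (\<lambda>f. ?st f = r) fs)) +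
        mset (map ?lift (filter (\<lambda>f. Suc r \<le> ?st f \<and> ?st f < Suc r + n) fs))"
      unfolding stage[OF Suc.prems] Suc.IH[of "Suc r", OF zero_less_Suc] ..
    also have "\<dots> = mset (map ?lift (filter (\<lambda>f. r \<le> ?st f \<and> ?st f < r + Suc n) fs))"
      by (induction fs) auto
    finally show ?case .
  qed
  from this[of 1 h] have "program_forms 1 (program_of h fs) =
      mset (map ?lift (filter (\<lambda>f. 1 \<le> ?st f \<and> ?st f < 1 + h) fs))"
    by (simp add: program_of_def)
  also have "filter (\<lambda>f. 1 \<le> ?st f \<and> ?st f < 1 + h) fs = fs"
    using assms by (auto simp: filter_id_conv)
  finally show "program_forms 1 (program_of h fs) = mset (map ?lift fs)" .
qed

text \<open>If every arrangement made some form divisible by \<open>p\<close>, then \<open>p\<close>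
  would divide the alternating sum, which is \<open>c\<close> times a Vandermonde determinant prime
  to \<open>p\<close>.\<close>

lemma exists_permutation_nonzero:
  fixes p :: nat
  assumes "prime p" "\<not> int p dvd c"
    and fs: "length fs = h choose 2" "\<forall>(l, q)\<in>set fs. l < q \<and> q \<le> h"
    and run: "tree_stages (program_of h fs) (add_layers h (zero_tree h)) = full_tree h c"
    and G: "map (\<lambda>(l, q, c). (l, q)) gs = fs"
    and b: "\<And>i j. i < j \<Longrightarrow> j < h \<Longrightarrow> \<not> int p dvd b i - b j"
  obtains \<sigma> where "\<sigma> permutes {..<h}" "\<And>g. g \<in> set gs \<Longrightarrow> \<not> int p dvd affine (b \<circ> \<sigma>) g"
proof -
  have p: "prime (int p)" using \<open>prime p\<close> by simp
  have "map (\<lambda>(l, q, c). (l, q, 0)) gs = map (\<lambda>(l, q). (l, q, 0 :: int)) fs"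
    unfolding G[symmetric] by auto
  then have "image_mset (\<lambda>(l, q, c). (l, q, 0)) (mset gs) = program_forms 1 (program_of h fs)"
    unfolding program_of(3)[OF fs(2)] by (simp flip: mset_map)
  moreover have "size (mset gs) = h choose 2" using fs(1) G by auto
  ultimately have "alt_term h b (\<lambda>_. 0) (mset gs) = c * alt_staircase h b"
    using alt_term_program[OF program_of(1,2)[OF fs(2)] _ _ run, of "mset gs" b] by simp
  moreover have "\<not> int p dvd alt_staircase h b"
    using p b by (auto simp: alt_staircase_eq prime_dvd_prod_iff)
  ultimately have "\<not> int p dvd alt_term h b (\<lambda>_. 0) (mset gs)"
    using p assms(2) by (simp add: prime_dvd_mult_iff)
  moreover have "int p dvd alt_term h b (\<lambda>_. 0) (mset gs)"
    if "\<And>\<sigma>. \<sigma> permutes {..<h} \<Longrightarrow> int p dvd (\<Prod>g\<in>#mset gs. affine (b \<circ> \<sigma>) g)"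
    unfolding alt_term_def alternator_def using that by (intro dvd_sum dvd_mult) auto
  ultimately obtain \<sigma> where \<sigma>: "\<sigma> permutes {..<h}"
    "\<not> int p dvd (\<Prod>g\<in>#mset gs. affine (b \<circ> \<sigma>) g)"
    by blast
  show ?thesis
  proof (rule that[OF \<sigma>(1)])
    fix g assume "g \<in> set gs"
    then have "affine (b \<circ> \<sigma>) g dvd (\<Prod>g\<in>#mset gs. affine (b \<circ> \<sigma>) g)"
      by (intro dvd_prod_mset) auto
    with \<sigma>(2) show "\<not> int p dvd affine (b \<circ> \<sigma>) g"
      by (meson dvd_trans)
  qed
qed

section \<open>Orderings with a greedy middle block\<close>

text \<open>Windows of length 1 and 2 are left out because the hypotheses on \<open>A\<close> settle
  them.\<close>

definition windows_nonzero :: "nat \<Rightarrow> nat \<Rightarrow> int list \<Rightarrow> bool" where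
  "windows_nonzero p t as \<longleftrightarrow>
    (\<forall>i j. i + 3 \<le> j \<and> j \<le> i + t \<and> j \<le> length as \<longrightarrow>
       \<not> int p dvd sum_list (take j as) - sum_list (take i as))"

lemma eq_if_dvd_add:
  fixes p :: nat
  assumes "a \<in> {0<..<int p}" "a' \<in> {0<..<int p}" "int p dvd z + a" "int p dvd z + a'"
  shows "a = a'"
proof (rule ccontr)
  assume "a \<noteq> a'"
  have "int p dvd \<bar>a - a'\<bar>" using dvd_diff[OF assms(3,4)] by simp
  then have "int p \<le> \<bar>a - a'\<bar>" using \<open>a \<noteq> a'\<close> by (intro zdvd_imp_le) auto
  then show False using assms(1,2) by auto
qed

text \<open>The next element must avoid the \<open>n\<close> placed ones and at most one element for
  each window length from 3 to 7; hence the 5 spare elements.\<close>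

lemma greedy_windows:
  fixes p :: nat
  assumes "A \<subseteq> {0<..<int p}" "n + 5 \<le> card A"
  obtains as where "distinct as" "set as \<subseteq> A" "length as = n" "windows_nonzero p 7 as"
  using assms(2)
proof (induction n arbitrary: thesis)
  case 0
  then show ?case by (intro "0"(1)[of "[]"]) (auto simp: windows_nonzero_def)
next
  case (Suc n)
  obtain as where as: "distinct as" "set as \<subseteq> A" "length as = n" "windows_nonzero p 7 as"
    using Suc.IH Suc.prems(2) by auto
  have fin: "finite A" using assms(1) by (rule finite_subset) auto
  \<comment> \<open>\<open>z l\<close> sums the last \<open>l - 1\<close> entries; for
    \<open>l > n + 1\<close> truncation gives the sum of all entries, a harmless extra
    exclusion.\<close>
  define z where "z l = sum_list as - sum_list (take (Suc n - l) as)" for l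
  define Z where "Z l = {a \<in> A. int p dvd z l + a}" for l
  have "card (Z l) \<le> 1" for l
    using assms(1) eq_if_dvd_add[of _ p _ "z l"] fin
    by (auto simp: Z_def card_le_Suc0_iff_eq subset_iff)
  then have "card (\<Union>l\<in>{3..7}. Z l) \<le> (\<Sum>l\<in>{3..7::nat}. 1)"
    by (intro order.trans[OF card_UN_le] sum_mono) auto
  moreover have "card (set as) = n" using as by (simp add: distinct_card)
  ultimately have "card (set as \<union> (\<Union>l\<in>{3..7}. Z l)) < card A"
    using card_Un_le[of "set as" "\<Union>l\<in>{3..7}. Z l"] Suc.prems(2) by simp
  then have "\<not> A \<subseteq> set as \<union> (\<Union>l\<in>{3..7}. Z l)"
    using card_mono[of "set as \<union> (\<Union>l\<in>{3..7}. Z l)" A] fin by (auto simp: Z_def)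
  then obtain a where a: "a \<in> A" "a \<notin> set as" "a \<notin> (\<Union>l\<in>{3..7}. Z l)" by blast
  then have nd: "\<not> int p dvd z l + a" if "l \<in> {3..7}" for l
    using that by (auto simp: Z_def)
  have "windows_nonzero p 7 (as @ [a])"
    unfolding windows_nonzero_def
  proof (intro allI impI)
    fix i j assume ij: "i + 3 \<le> j \<and> j \<le> i + 7 \<and> j \<le> length (as @ [a])"
    show "\<not> int p dvd sum_list (take j (as @ [a])) - sum_list (take i (as @ [a]))"
    proof (cases "j \<le> n")
      case True
      then show ?thesis using ij as(3,4) by (simp add: windows_nonzero_def)
    next
      case False
      then have "Suc n - (j - i) = i" "j = Suc n" "j - i \<in> {3..7}" using ij as(3) by auto
      then show ?thesis using nd[of "j - i"] as(3) ij by (simp add: z_def algebra_simps)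
    qed
  qed
  then show ?case using Suc.prems(1)[of "as @ [a]"] as a by auto
qed

text \<open>
  An ordering is cut into a left part of length \<open>r\<close>, a fixed block of length \<open>m\<close> and a right part of
  length \<open>s\<close>, and the free elements \<open>x\<^sub>0, x\<^sub>1, \<dots>\<close> are read along the right part and then along the
  left one. Up to a constant that does not depend on the order of the free elements, the \<open>i\<close>-th
  partial sum is \<open>x\<^sub>0 + \<dots> + x\<^bsub>u-1\<^esub>\<close> for \<open>u = free_index r m s i\<close>: as the sum of all free
  elements is constant, the whole left part may be dropped from it. Truncated subtraction makes the
  index \<open>0\<close> throughout the fixed block.
\<close>

definition free_index :: "nat \<Rightarrow> nat \<Rightarrow> nat \<Rightarrow> nat \<Rightarrow> nat" where
  "free_index r m s i = (if i < r then s + i else i - r - m)"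

definition window_pairs :: "nat \<Rightarrow> nat \<Rightarrow> nat \<Rightarrow> nat \<Rightarrow> (nat \<times> nat) list" where
  "window_pairs r m s t =
    filter (\<lambda>(i, j). free_index r m s i \<noteq> free_index r m s j)
      (concat (map (\<lambda>i. map (Pair i) [i + 3..<Suc (min (r + m + s) (i + t))]) [0..<r + m + s]))"

text \<open>A window that leaves the left part is, up to a constant, the negative of the sum of the
  free elements it misses. This explains \<open>min\<close> and \<open>max\<close>; signs do not
  affect divisibility.\<close>

definition window_forms :: "nat \<Rightarrow> nat \<Rightarrow> nat \<Rightarrow> nat \<Rightarrow> (nat \<times> nat) list" where
  "window_forms r m s t =
    map (\<lambda>(i, j). let u = free_index r m s i; v = free_index r m s j in (min u v, max u v))
      (window_pairs r m s t)"

text \<open>The indices \<open>e\<close> stand for arbitrary further forms that pad the degree.\<close>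

definition certificate :: "nat \<Rightarrow> nat \<Rightarrow> nat \<Rightarrow> nat \<Rightarrow> nat list \<Rightarrow> int \<Rightarrow> bool" where
  "certificate r m s t e c \<longleftrightarrow> (let h = r + s; fs = window_forms r m s t @ map (Pair 0) e in
     length fs = h choose 2 \<and> (\<forall>(l, q)\<in>set fs. l < q \<and> q \<le> h) \<and>
     tree_stages (program_of h fs) (add_layers h (zero_tree h)) = full_tree h c)"

text \<open>From position \<open>r\<close> on, the sum of the left part is rewritten as the total of
  the free elements minus the sum of the right part.\<close>

lemma sum_list_take_blocks:
  fixes x :: "nat \<Rightarrow> int"
  assumes "i \<le> r + length F + s"
  shows "sum_list (take i (map x [s..<r + s] @ F @ map x [0..<s])) =
    (\<Sum>l<free_index r (length F) s i. x l) - (\<Sum>l<s. x l) +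
    (if i < r then 0 else (\<Sum>l<r + s. x l) + sum_list (take (i - r) F))"
proof -
  have sum: "sum_list (map x [a..<b]) = (\<Sum>l<b. x l) - (\<Sum>l<a. x l)" if "a \<le> b" for a b
    using that sum.atLeastLessThan_concat[of 0 a b x]
    by (simp add: interv_sum_list_conv_sum_set_nat lessThan_atLeast0)
  consider "i < r" | "r \<le> i" "i \<le> r + length F" | "r + length F < i" by linarith
  then show ?thesis
    using assms by cases (auto simp: sum free_index_def take_map take_upt min_def)
qed

text \<open>
  The middle block may be longer than in the certificate by \<open>d\<close> elements: if \<open>m \<ge> 6\<close>, no window
  of length at most 7 meets both ends.
\<close>

lemma sequencing_of_certificate:
  fixes p :: nat
  assumes cert: "certificate r m s t e c" and p: "prime p" "\<not> int p dvd c"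
    and A: "A \<subseteq> {0<..<int p}" "card A = r + m + s + d"
    and t: "t \<le> 7" "t < r + s"
    and d: "d = 0 \<or> 6 \<le> m" and free: "m + d = 0 \<or> 5 \<le> r + s"
  shows "\<exists>as. distinct as \<and> set as = A \<and> windows_nonzero p t as"
proof -
  let ?h = "r + s" and ?M = "m + d"
  let ?u = "free_index r m s" and ?U = "free_index r ?M s"
  have fin: "finite A" using A(1) by (rule finite_subset) auto
  obtain F where F: "distinct F" "set F \<subseteq> A" "length F = ?M" "windows_nonzero p 7 F"
  proof (cases "?M = 0")
    case True
    then show ?thesis by (intro that[of "[]"]) (auto simp: windows_nonzero_def)
  next
    case False
    then show ?thesis using greedy_windows[OF A(1), of ?M] A(2) free that by auto
  qed
  have "card (A - set F) = ?h"
    using F A(2) fin by (simp add: card_Diff_subset distinct_card)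
  then obtain bs where bs: "distinct bs" "set bs = A - set F" "length bs = ?h"
    using finite_distinct_list[of "A - set F"] fin by (metis distinct_card finite_Diff)
  define b where "b i = bs ! i" for i
  \<comment> \<open>The part of the \<open>i\<close>-th partial sum that no rearrangement changes,
    up to the sum of the right part, which cancels in differences.\<close>
  define K where "K i = (if i < r then 0 else (\<Sum>l<?h. b l) + sum_list (take (i - r) F))" for i
  \<comment> \<open>Translates positions of the certificate to the longer block. If
    \<open>d > 0\<close>, a window starting in the left part ends before the right part and stays in
    place, while every other window moves by \<open>d\<close>.\<close>
  define shift where "shift i n = (if i < r then n else n + d)" for i n
  define gs where "gs =
    map (\<lambda>(i, j). let D = K (shift i j) - K (shift i i) in
      (min (?u i) (?u j), max (?u i) (?u j), if ?u i < ?u j then D else - D)) (window_pairs r m s t)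
    @ map (\<lambda>q. (0, q, 0)) e"
  obtain \<sigma> where \<sigma>: "\<sigma> permutes {..<?h}"
    and nz: "\<And>g. g \<in> set gs \<Longrightarrow> \<not> int p dvd affine (b \<circ> \<sigma>) g"
  proof -
    let ?fs = "window_forms r m s t @ map (Pair 0) e"
    have fs: "length ?fs = ?h choose 2" "\<forall>(l, q)\<in>set ?fs. l < q \<and> q \<le> ?h"
      "tree_stages (program_of ?h ?fs) (add_layers ?h (zero_tree ?h)) = full_tree ?h c"
      using cert unfolding certificate_def Let_def by blast+
    have gs: "map (\<lambda>(l, q, c). (l, q)) gs = ?fs"
      by (simp add: gs_def window_forms_def Let_def case_prod_unfold comp_def)
    have "\<not> int p dvd b i - b j" if "i < j" "j < ?h" for i j
    proof
      assume "int p dvd b i - b j"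
      moreover have "b i \<in> {0<..<int p}" "b j \<in> {0<..<int p}" "b i \<noteq> b j"
        using that bs A(1) nth_mem[of i bs] nth_mem[of j bs]
        by (auto simp: b_def nth_eq_iff_index_eq)
      ultimately show False using eq_if_dvd_add[of "b i" p "b j" "- b j"] by simp
    qed
    then show ?thesis
      using exists_permutation_nonzero[OF p fs gs] that by blast
  qed
  define x where "x = b \<circ> \<sigma>"
  define as where "as = map x [s..<?h] @ F @ map x [0..<s]"
  have mset: "mset as = mset bs + mset F"
  proof -
    have "mset as = mset (map x [0..<?h]) + mset F"
      unfolding as_def using upt_add_eq_append[of 0 s r] by (simp add: add.commute)
    also have "mset (map x [0..<?h]) = image_mset b (image_mset \<sigma> (mset_set {..<?h}))"
      by (simp add: x_def multiset.map_comp lessThan_atLeast0)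
    also have "image_mset \<sigma> (mset_set {..<?h}) = mset_set {..<?h}"
      using \<sigma> by (simp add: image_mset_mset_set permutes_image permutes_inj_on)
    also have "image_mset b (mset_set {..<?h}) = mset (map b [0..<?h])"
      by (simp add: lessThan_atLeast0)
    also have "map b [0..<?h] = bs" using map_nth[of bs] by (simp add: b_def[abs_def] bs(3))
    finally show ?thesis .
  qed
  then have set: "set as = A" using bs F by (metis Diff_partition Un_commute set_mset_mset set_mset_union)
  have len: "length as = r + ?M + s" by (simp add: as_def F)
  have "distinct as"
    using set len A(2) card_distinct[of as] by simp
  have "(\<Sum>l<?h. x l) = (\<Sum>l<?h. b l)"
    using sum.permute[OF \<sigma>, of b] by (simp add: x_def)
  then have take: "sum_list (take i as) = (\<Sum>l<?U i. x l) - (\<Sum>l<s. x l) + K i" if "i \<le> length as" for i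
    using sum_list_take_blocks[of i r F s x] that len F(3) by (simp add: as_def K_def)
  have "windows_nonzero p t as"
    unfolding windows_nonzero_def
  proof (intro allI impI, elim conjE)
    fix i j assume ij: "i + 3 \<le> j" "j \<le> i + t" "j \<le> length as"
    show "\<not> int p dvd sum_list (take j as) - sum_list (take i as)"
    proof (cases "?U i = ?U j")
      case True
      \<comment> \<open>Equal indices occur only inside the fixed block: a window containing all
        free elements is longer than \<open>t\<close>, as \<open>t < r + s\<close>.\<close>
      then have "r \<le> i" "j \<le> r + ?M"
        using ij t len by (auto simp: free_index_def split: if_splits)
      then have "\<not> int p dvd sum_list (take (j - r) F) - sum_list (take (i - r) F)"
        using F(3) ij t by (intro F(4)[unfolded windows_nonzero_def, rule_format]) auto
      then show ?thesis
        using True \<open>r \<le> i\<close> ij take[of i] take[of j] by (simp add: K_def)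
    next
      case False
      obtain i' j' where i'j': "i' + 3 \<le> j'" "j' \<le> i' + t" "j' \<le> r + m + s"
        "shift i' i' = i" "shift i' j' = j" "?u i' = ?U i" "?u j' = ?U j"
      proof (cases "i < r")
        case True
        then show ?thesis using that[of i j] d ij len t by (auto simp: shift_def free_index_def)
      next
        case ir: False
        show ?thesis
        proof (cases "d = 0")
          case True
          then show ?thesis using that[of i j] ij len by (auto simp: shift_def)
        next
          case False
          have "r + ?M < j" using \<open>?U i \<noteq> ?U j\<close> ir ij by (auto simp: free_index_def split: if_splits)
          \<comment> \<open>The window ends in the right part and has length at most 7, so
            \<open>m \<ge> 6\<close> leaves room to move it back by \<open>d\<close>.\<close>
          then have "r + d \<le> i" using d False ij t by auto
          then have "d \<le> i" "d \<le> j" "\<not> i - d < r" "\<not> j - d < r" "\<not> j < r" using ij by auto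
          then show ?thesis
            using ij len ir
            by (intro that[of "i - d" "j - d"]) (simp_all add: shift_def free_index_def)
        qed
      qed
      then have "(i', j') \<in> set (window_pairs r m s t)"
        using False by (auto simp: window_pairs_def image_iff)
      then have "\<not> int p dvd affine x (min (?U i) (?U j), max (?U i) (?U j),
          if ?U i < ?U j then K j - K i else - (K j - K i))"
        using nz i'j' unfolding x_def gs_def by (force simp: Let_def)
      moreover have seg: "(\<Sum>l\<in>{a..<b}. x l) = (\<Sum>l<b. x l) - (\<Sum>l<a. x l)" if "a \<le> b" for a b
        using that sum.atLeastLessThan_concat[of 0 a b x] by (simp add: lessThan_atLeast0)
      have "sum_list (take j as) - sum_list (take i as) =
          (\<Sum>l<?U j. x l) - (\<Sum>l<?U i. x l) + (K j - K i)"
        using ij take[of i] take[of j] by simp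
      then have "affine x (min (?U i) (?U j), max (?U i) (?U j),
          if ?U i < ?U j then K j - K i else - (K j - K i)) =
          (if ?U i < ?U j then 1 else - 1) * (sum_list (take j as) - sum_list (take i as))"
        by (simp add: affine_def min_def max_def seg)
      ultimately show ?thesis
        by (metis dvd_mult)
    qed
  qed
  with \<open>distinct as\<close> set show ?thesis by blast
qed

section \<open>The coefficients\<close>

text \<open>
  Shapes and padding were found by computer search. Where a single coefficient has prime factors
  larger than twice the number of elements, a second one with a small common divisor is added.
\<close>

lemma certificate_4: "certificate 4 0 0 3 [1, 1, 2, 3] 1"
  by code_simp

lemma certificate_5: "certificate 5 0 0 4 [1, 1, 1, 2, 2] 1"
  by code_simp

lemma certificate_6: "certificate 6 0 0 5 [1, 1, 1, 1, 5, 5] (- 2)"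
  by code_simp

lemma certificate_7: "certificate 7 0 0 6 [1, 1, 1, 1, 1, 6, 6] 22"
  by code_simp

lemma certificate_8: "certificate 8 0 0 7 [1, 1, 1, 1, 1, 1, 5, 5] (- 1200)"
  by code_simp

lemma certificate_9:
  "certificate 8 1 0 7 [1, 1, 2] 930019"
  "certificate 8 1 0 7 [1, 1, 1] 489144"
  by code_simp+

lemma certificate_10:
  "certificate 10 0 0 7 [1, 1, 1, 1, 1, 1, 1, 1, 1, 2, 2, 2, 2, 2, 3] (- 459574105)"
  "certificate 10 0 0 7 [1, 1, 1, 1, 1, 1, 1, 1, 1, 2, 2, 2, 2, 2, 2] (- 175641386)"
  by code_simp+

lemma certificate_11:
  "certificate 5 2 4 7 [1] (- 7716315636)"
  "certificate 5 2 4 7 [2] (- 12754656836)"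
  by code_simp+

lemma certificate_12:
  "certificate 6 2 4 7 [1, 1, 1, 1, 2] 3668884721187"
  "certificate 6 2 4 7 [1, 1, 1, 1, 1] 1388110818236"
  by code_simp+

lemma certificate_13:
  "certificate 5 3 5 7 [5] 26526384099382"
  "certificate 5 3 5 7 [1] 5502279418430"
  by code_simp+

lemma certificate_14:
  "certificate 6 3 5 7 [1, 1, 1, 1, 1, 1] (- 298988653572430)"
  "certificate 6 3 5 7 [1, 1, 1, 1, 1, 2] (- 1159767658267718)"
  by code_simp+

lemma certificate_15:
  "certificate 6 4 5 7 [1, 1, 1] 4215199570267428"
  "certificate 6 4 5 7 [1, 1, 2] 10024058015744236"
  by code_simp+

lemma certificate_16:
  "certificate 5 5 6 7 [2] 10006242588171625"
  "certificate 5 5 6 7 [1] 5133711476695366"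
  by code_simp+

text \<open>Both blocks have length 6, so these shapes extend to all larger sizes through
  \<open>d\<close>. The windows alone already give \<open>11 choose 2\<close> forms.\<close>

lemma certificate_17:
  "certificate 5 6 6 7 [] 6396255092713020"
  "certificate 4 6 7 7 [] (- 3353373981254935)"
  by code_simp+

text \<open>All listed factors of the gcd are below \<open>p\<close>, so \<open>p\<close> misses one
  of the two coefficients. Where a single coefficient suffices, its certificate is used
  twice.\<close>

lemma sequencing_of_certificate_pair:
  fixes p :: nat
  assumes cert: "certificate r m s t e c" "certificate r' m' s' t e' c'"
    and gcd: "gcd c c' = prod_list qs" "\<forall>q\<in>set qs. 0 < q \<and> q < int p"
    and p: "prime p" and A: "A \<subseteq> {0<..<int p}" "card A = r + m + s + d" "card A = r' + m' + s' + d"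
    and t: "t \<le> 7" "t < r + s" "t < r' + s'"
    and d: "d = 0 \<or> 6 \<le> m \<and> 6 \<le> m'"
    and free: "m + d = 0 \<or> 5 \<le> r + s" "m' + d = 0 \<or> 5 \<le> r' + s'"
  shows "\<exists>as. distinct as \<and> set as = A \<and> windows_nonzero p t as"
proof -
  have "\<not> int p dvd prod_list qs" using gcd(2)
  proof (induction qs)
    case Nil
    then show ?case using prime_gt_1_nat[OF p] by simp
  next
    case (Cons q qs)
    then have "\<not> int p dvd q" using zdvd_imp_le[of "int p" q] by auto
    then show ?case using Cons p by (simp add: prime_dvd_mult_iff)
  qed
  then have "\<not> int p dvd c \<or> \<not> int p dvd c'" by (metis gcd(1) gcd_greatest)
  then show ?thesis
    using sequencing_of_certificate[OF cert(1) p _ A(1,2) t(1,2) _ free(1)]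
      sequencing_of_certificate[OF cert(2) p _ A(1,3) t(1,3) _ free(2)] d by blast
qed

lemma exists_sequencing:
  fixes p :: nat
  assumes p: "prime p" and A: "A \<subseteq> {0<..<int p}" and k: "2 * card A < p" "4 \<le> card A"
  shows "\<exists>as. distinct as \<and> set as = A \<and> windows_nonzero p (min 7 (card A - 1)) as"
proof -
  have "card A = 4 \<or> card A = 5 \<or> card A = 6 \<or> card A = 7 \<or>
    card A = 8 \<or> card A = 9 \<or> card A = 10 \<or> card A = 11 \<or>
    card A = 12 \<or> card A = 13 \<or> card A = 14 \<or> card A = 15 \<or>
    card A = 16 \<or> 17 \<le> card A"
    using k(2) by presburger
  then show ?thesis
  proof (elim disjE)
    assume c: "card A = 4"
    have "gcd 1 1 = prod_list ([] :: int list)" by code_simp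
    from sequencing_of_certificate_pair[OF certificate_4 certificate_4 this _ p A, of 0]
    show ?thesis using c k(1) by simp
  next
    assume c: "card A = 5"
    have "gcd 1 1 = prod_list ([] :: int list)" by code_simp
    from sequencing_of_certificate_pair[OF certificate_5 certificate_5 this _ p A, of 0]
    show ?thesis using c k(1) by simp
  next
    assume c: "card A = 6"
    have "gcd (- 2) (- 2) = prod_list ([2] :: int list)" by code_simp
    from sequencing_of_certificate_pair[OF certificate_6 certificate_6 this _ p A, of 0]
    show ?thesis using c k(1) by simp
  next
    assume c: "card A = 7"
    have "gcd 22 22 = prod_list ([2, 11] :: int list)" by code_simp
    from sequencing_of_certificate_pair[OF certificate_7 certificate_7 this _ p A, of 0]
    show ?thesis using c k(1) by simp
  next
    assume c: "card A = 8"
    have "gcd (- 1200) (- 1200) = prod_list ([2, 2, 2, 2, 3, 5, 5] :: int list)" by code_simp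
    from sequencing_of_certificate_pair[OF certificate_8 certificate_8 this _ p A, of 0]
    show ?thesis using c k(1) by simp
  next
    assume c: "card A = 9"
    have "gcd 930019 489144 = prod_list ([] :: int list)" by code_simp
    from sequencing_of_certificate_pair[OF certificate_9(1) certificate_9(2) this _ p A, of 0]
    show ?thesis using c k(1) by simp
  next
    assume c: "card A = 10"
    have "gcd (- 459574105) (- 175641386) = prod_list ([] :: int list)" by code_simp
    from sequencing_of_certificate_pair[OF certificate_10(1) certificate_10(2) this _ p A, of 0]
    show ?thesis using c k(1) by simp
  next
    assume c: "card A = 11"
    have "gcd (- 7716315636) (- 12754656836) = prod_list ([2, 2] :: int list)" by code_simp
    from sequencing_of_certificate_pair[OF certificate_11(1) certificate_11(2) this _ p A, of 0]
    show ?thesis using c k(1) by simp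
  next
    assume c: "card A = 12"
    have "gcd 3668884721187 1388110818236 = prod_list ([] :: int list)" by code_simp
    from sequencing_of_certificate_pair[OF certificate_12(1) certificate_12(2) this _ p A, of 0]
    show ?thesis using c k(1) by simp
  next
    assume c: "card A = 13"
    have "gcd 26526384099382 5502279418430 = prod_list ([2] :: int list)" by code_simp
    from sequencing_of_certificate_pair[OF certificate_13(1) certificate_13(2) this _ p A, of 0]
    show ?thesis using c k(1) by simp
  next
    assume c: "card A = 14"
    have "gcd (- 298988653572430) (- 1159767658267718) = prod_list ([2] :: int list)" by code_simp
    from sequencing_of_certificate_pair[OF certificate_14(1) certificate_14(2) this _ p A, of 0]
    show ?thesis using c k(1) by simp
  next
    assume c: "card A = 15"
    have "gcd 4215199570267428 10024058015744236 = prod_list ([2, 2] :: int list)" by code_simp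
    from sequencing_of_certificate_pair[OF certificate_15(1) certificate_15(2) this _ p A, of 0]
    show ?thesis using c k(1) by simp
  next
    assume c: "card A = 16"
    have "gcd 10006242588171625 5133711476695366 = prod_list ([] :: int list)" by code_simp
    from sequencing_of_certificate_pair[OF certificate_16(1) certificate_16(2) this _ p A, of 0]
    show ?thesis using c k(1) by simp
  next
    assume c: "17 \<le> card A"
    \<comment> \<open>Here \<open>p > 34\<close>, so the common factors 5 and 29 are both below
      \<open>p\<close>.\<close>
    have "gcd 6396255092713020 (- 3353373981254935) = prod_list ([5, 29] :: int list)" by code_simp
    from sequencing_of_certificate_pair[OF certificate_17(1) certificate_17(2) this _ p A, of "card A - 17"]
    show ?thesis using c k(1) by simp
  qed
qed

section \<open>Passage to the group of residues\<close>

lemma partial_sum_integer_mod_group: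
  assumes "set as \<subseteq> carrier (integer_mod_group p)" "i \<le> length as"
  shows "partial_sum (integer_mod_group p) as i = sum_list (take i as) mod int p"
proof -
  interpret comm_group "integer_mod_group p" by simp
  have carrier: "as ! j \<in> carrier (integer_mod_group p)" if "j < length as" for j
    using that assms(1) by auto
  show ?thesis using assms(2)
  proof (induction i)
    case 0
    then show ?case by (simp add: partial_sum_def)
  next
    case (Suc i)
    have "partial_sum (integer_mod_group p) as (Suc i) =
        (as ! i + partial_sum (integer_mod_group p) as i) mod int p"
      using Suc.prems carrier by (simp add: partial_sum_def lessThan_Suc Pi_iff)
    then show ?case
      using Suc by (simp add: take_Suc_conv_app_nth mod_simps add.commute)
  qed
qed

theorem theorem2p11:
  fixes p t :: nat and A :: "int set"
  assumes "prime p"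
    and "0 < t" and "t \<le> 7"
    and "finite A"
    and "A \<subseteq> carrier (integer_mod_group p) - {\<one>\<^bsub>integer_mod_group p\<^esub>}"
    and "\<forall>x\<in>carrier (integer_mod_group p). card (A \<inter> {x, inv\<^bsub>integer_mod_group p\<^esub> x}) \<le> 1"
    and "t < card A"
  shows "weak_sequenceable (integer_mod_group p) t A"
proof -
  have "p > 1" using assms(1) by (rule prime_gt_1_nat)
  then have carrier: "carrier (integer_mod_group p) = {0..<int p}"
    by (simp add: carrier_integer_mod_group)
  then have A: "A \<subseteq> {0<..<int p}" using assms(5) by auto
  have inv: "inv\<^bsub>integer_mod_group p\<^esub> a = int p - a" if "a \<in> A" for a
  proof -
    have "inv\<^bsub>integer_mod_group p\<^esub> a = (int p - a) mod int p"
      using that A by (subst inv_integer_mod_group) (auto simp: carrier)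
    also have "\<dots> = int p - a" using that A by (intro mod_pos_pos_trivial) auto
    finally show ?thesis .
  qed
  have single: "card (A \<inter> {a, int p - a}) \<le> 1" if "a \<in> A" for a
    using bspec[OF assms(6), of a] inv[OF that] that A by (auto simp: carrier)
  have pair: "\<not> int p dvd a + a'" if "a \<in> A" "a' \<in> A" "a \<noteq> a'" for a a'
  proof
    assume "int p dvd a + a'"
    then have "a' = int p - a"
      using that(1,2) A \<open>int p dvd a + a'\<close>
      by (intro eq_if_dvd_add[of a' p "int p - a" a]) (auto simp: subset_iff)
    then have "A \<inter> {a, int p - a} = {a, a'}" using that by auto
    then show False using single[of a] that by simp
  qed
  \<comment> \<open>\<open>A\<close> and its opposites are disjoint sets of nonzero residues: an
    element equal to its own opposite would force \<open>p = 2\<close>, leaving at most one element,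
    against \<open>t < card A\<close>.\<close>
  have two: "2 * card A < p"
  proof -
    have "int p - a \<noteq> a'" if "a \<in> A" "a' \<in> A" for a a'
    proof
      assume a': "int p - a = a'"
      then have sum: "a + a' = int p" by simp
      then have "a = a'" using pair[OF that] by (metis dvd_refl)
      then have "int p = 2 * a" using sum by simp
      then have "even (int p)" by simp
      then have "p = 2" using primes_dvd_imp_eq[OF two_is_prime_nat assms(1)] by simp
      then have "A \<subseteq> {1}" using A by auto
      then have "card A \<le> 1" using card_mono[of "{1}" A] by simp
      then show False using assms(2,7) by simp
    qed
    then have "A \<inter> (\<lambda>a. int p - a) ` A = {}" by auto
    then have "card (A \<union> (\<lambda>a. int p - a) ` A) = card A + card A"
      using assms(4) by (simp add: card_Un_disjoint card_image inj_on_def)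
    moreover have "card (A \<union> (\<lambda>a. int p - a) ` A) \<le> card {0<..<int p}"
      using A by (intro card_mono) auto
    ultimately show ?thesis using \<open>p > 1\<close> by simp
  qed
  obtain as where as: "distinct as" "set as = A" "windows_nonzero p (min 7 (card A - 1)) as"
  proof (cases "4 \<le> card A")
    case True
    then show ?thesis using exists_sequencing[OF assms(1) A two] that by blast
  next
    \<comment> \<open>With at most three elements the length bound \<open>card A - 1\<close> is at
      most 2, so no window of length 3 or more is constrained.\<close>
    case False
    obtain as where "distinct as" "set as = A" using finite_distinct_list[OF assms(4)] by blast
    then show ?thesis using False that by (force simp: windows_nonzero_def)
  qed
  have len: "length as = card A" using as by (metis distinct_card)
  have ne: "partial_sum (integer_mod_group p) as i \<noteq> partial_sum (integer_mod_group p) as j"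
    if "i < j" "j \<le> i + t" "j \<le> card A" for i j
  proof -
    have "\<not> int p dvd sum_list (take j as) - sum_list (take i as)"
    proof -
      \<comment> \<open>Length 1 uses that elements are nonzero, length 2 that no two are opposite;
        longer windows are covered because \<open>t \<le> min 7 (card A - 1)\<close>.\<close>
      consider "j = Suc i" | "j = Suc (Suc i)" | "i + 3 \<le> j" using \<open>i < j\<close> by linarith
      then show ?thesis
      proof cases
        case 1
        then have "as ! i \<in> {0<..<int p}" using A as(2) that len nth_mem[of i as] by auto
        then show ?thesis using 1 that len zdvd_not_zless[of "as ! i" "int p"]
          by (simp add: take_Suc_conv_app_nth)
      next
        case 2
        then have "\<not> int p dvd as ! i + as ! Suc i"
          using pair[of "as ! i" "as ! Suc i"] as that len by (auto simp: nth_eq_iff_index_eq)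
        then show ?thesis using 2 that len by (simp add: take_Suc_conv_app_nth)
      next
        case 3
        then show ?thesis using as(3) that len assms(3,7) by (auto simp: windows_nonzero_def)
      qed
    qed
    moreover have "set as \<subseteq> carrier (integer_mod_group p)" using as(2) A carrier by auto
    note partial_sum_integer_mod_group[OF this]
    ultimately show ?thesis
      using that len by (simp add: mod_eq_dvd_iff dvd_diff_commute)
  qed
  have "weak_sequencing (integer_mod_group p) t A as"
    unfolding weak_sequencing_def
  proof (intro conjI ballI impI)
    fix i j assume ij: "i \<in> {0..card A}" "j \<in> {0..card A}" "i \<noteq> j \<and> \<bar>int i - int j\<bar> \<le> int t"
    then consider "i < j" "j \<le> i + t" | "j < i" "i \<le> j + t" by linarith
    then show "partial_sum (integer_mod_group p) as i \<noteq> partial_sum (integer_mod_group p) as j"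
      using ne[of i j] ne[of j i] ij by cases auto
  qed (use as in auto)
  then show ?thesis by (auto simp: weak_sequenceable_def)
qed

end
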